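(* The submodular maximization problem with a stochastic knapsack capacity, without cancellation, admits a pseudo-polynomial time randomized $(1/4-o(1))$-approximation algorithm for monotone submodular functions.
   Context: Submodular maximization problem with a stochastic knapsack capacity, without cancellation: an instance consists of a set $I$ of $n$ items with positive integer sizes $s(i)$, a monotone submodular function $f\colon 2^I\to\mathbb{R}_+$ with $f(\emptyset)=0$ given by a value oracle, and a probability distribution of the capacity $C$ on $\{0,1,\dots,T\}$, where $T=\sum_{i\in I}s(i)$. With $p(t)=\Pr[C=t]$, the distribution is given by an oracle returning $\sum_{t'=t}^{T}p(t')$ for any queried $t\in\{0,\dots,T\}$. A solution is a sequence $\Pi=(\Pi_1,\dots,\Pi_n)$ of the items of $I$. For a realized capacity $C$, the output $\Pi(C)$ is the set of items in the longest prefix of $\Pi$ whose total size is at most $C$ (items are added in order and the process stops at the first item that does not fit). The objective is to maximize $\mathbb{E}_C[f(\Pi(C))]$ over sequences $\Pi$. A randomized algorithm is an $\alpha$-approximation algorithm if on every instance it outputs a sequence whose objective value is, in expectation over the algorithm's randomness, at least $\alpha$ times the maximum objective value. The input size of an instance is $\Theta(n\log T)$, and an algorithm is said to run in pseudo-polynomial time if its running time depends on $T$ linearly. It is assumed, for simplicity, that the multilinear extension $F(x)=\sum_{X\subseteq I}f(X)\prod_{i\in X}x_i\prod_{i\in I\setminus X}(1-x_i)$, $x\in[0,1]^I$, of a submodular function $f$ can be computed exactly. The term $o(1)$ tends to $0$ as the size of the instance grows. *)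

theory Defs
  imports
    "HOL-Probability.Probability"
    "HOL-Combinatorics.Multiset_Permutations"
    "HOL-Library.Landau_Symbols"
begin

section \<open>The problem\<close>

text \<open>The item set \<open>I\<close> is encoded as \<open>{..<items J}\<close>; \<open>cap J\<close> is the law of the capacity \<open>C\<close>.\<close>

record knapsack =
  items :: nat
  size_of :: "nat \<Rightarrow> nat"
  val :: "nat set \<Rightarrow> real"
  cap :: "nat pmf"

definition item_set :: "knapsack \<Rightarrow> nat set" where
  "item_set J = {..<items J}"

definition total_size :: "knapsack \<Rightarrow> nat" where
  "total_size J = (\<Sum>i\<in>item_set J. size_of J i)"

definition submodular_on :: "'a set \<Rightarrow> ('a set \<Rightarrow> real) \<Rightarrow> bool" where
  "submodular_on I f \<longleftrightarrow>
     (\<forall>X Y. X \<subseteq> I \<longrightarrow> Y \<subseteq> I \<longrightarrow> f (X \<union> Y) + f (X \<inter> Y) \<le> f X + f Y)"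

definition valid_instance :: "knapsack \<Rightarrow> bool" where
  "valid_instance J \<longleftrightarrow>
     (\<forall>i\<in>item_set J. 0 < size_of J i) \<and>
     (\<forall>X\<in>Pow (item_set J). 0 \<le> val J X) \<and>
     val J {} = 0 \<and>
     mono_on (Pow (item_set J)) (val J) \<and>
     submodular_on (item_set J) (val J) \<and>
     set_pmf (cap J) \<subseteq> {0..total_size J}"

definition solutions :: "knapsack \<Rightarrow> nat list set" where
  "solutions J = permutations_of_set (item_set J)"

definition fits :: "knapsack \<Rightarrow> nat list \<Rightarrow> nat \<Rightarrow> bool" where
  "fits J ys C \<longleftrightarrow> sum_list (map (size_of J) ys) \<le> C"

definition packed :: "knapsack \<Rightarrow> nat list \<Rightarrow> nat \<Rightarrow> nat set" where
  "packed J xs C = set (take (GREATEST k. k \<le> length xs \<and> fits J (take k xs) C) xs)"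

definition objective :: "knapsack \<Rightarrow> nat list \<Rightarrow> real" where
  "objective J xs = measure_pmf.expectation (cap J) (\<lambda>C. val J (packed J xs C))"

definition opt :: "knapsack \<Rightarrow> real" where
  "opt J = Max (objective J ` solutions J)"

text \<open>The input size \<open>\<Theta>(n log T)\<close>; \<open>T + 1\<close> avoids the degenerate value of the logarithm at
  \<open>T \<le> 1\<close>.\<close>

definition input_size :: "knapsack \<Rightarrow> real" where
  "input_size J = real (items J) * log 2 (real (total_size J) + 1)"

section \<open>Oracles\<close>

definition tail_oracle :: "knapsack \<Rightarrow> nat \<Rightarrow> real" where
  "tail_oracle J t = (\<Sum>t'=t..total_size J. pmf (cap J) t')"

definition multilinear_extension :: "'a set \<Rightarrow> ('a set \<Rightarrow> real) \<Rightarrow> ('a \<Rightarrow> real) \<Rightarrow> real" where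
  "multilinear_extension I f x =
     (\<Sum>X\<in>Pow I. f X * (\<Prod>i\<in>X. x i) * (\<Prod>i\<in>I - X. 1 - x i))"

text \<open>Queries outside \<open>[0,1]\<^sup>I\<close> are answered by 0, so the oracle reveals \<open>F\<close> only on its domain.\<close>

definition multilinear_oracle :: "knapsack \<Rightarrow> (nat \<Rightarrow> real) \<Rightarrow> real" where
  "multilinear_oracle J x =
     (if \<forall>i\<in>item_set J. x i \<in> {0..1} then multilinear_extension (item_set J) (val J) x else 0)"

section \<open>Randomized algorithms\<close>

text \<open>
  An algorithm is a finite program of an imperative language over a random access memory with
  natural-number cells and real cells (values of \<open>f\<close> are arbitrary reals), both addressed by pairs
  (row, column). Only natural-number constants occur in programs. To keep unit cost honest, there is
  neither multiplication on natural-number cells nor a conversion from reals to natural numbers.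
  \<open>Value a\<close> queries \<open>f\<close> on the set of items whose entries in row \<open>a\<close> are nonzero, and
  \<open>Multilinear a\<close> queries \<open>F\<close> at the vector stored in real row \<open>a\<close>. The total size \<open>T\<close> is
  not a primitive: it has to be computed from the item sizes.
\<close>

datatype nexp =
    Num nat
  | Items
  | SizeOf nexp
  | NCell nexp nexp
  | NAdd nexp nexp
  | NSub nexp nexp

datatype rexp =
    OfNat nexp
  | RCell nexp nexp
  | RAdd rexp rexp
  | RSub rexp rexp
  | RMul rexp rexp
  | RDiv rexp rexp
  | Tail nexp
  | Value nexp
  | Multilinear nexp

datatype bexp =
    NLess nexp nexp
  | RLess rexp rexp
  | BNot bexp
  | BAnd bexp bexp

datatype com =
    Skip
  | NStore nexp nexp nexp
  | RStore nexp nexp rexp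
  | Toss nexp nexp
  | Seq com com
  | Cond bexp com com
  | Loop bexp com

record memory =
  nmem :: "nat \<Rightarrow> nat \<Rightarrow> nat"
  rmem :: "nat \<Rightarrow> nat \<Rightarrow> real"

primrec neval :: "knapsack \<Rightarrow> nexp \<Rightarrow> memory \<Rightarrow> nat" where
  "neval J (Num k) m = k"
| "neval J Items m = items J"
| "neval J (SizeOf e) m = (if neval J e m \<in> item_set J then size_of J (neval J e m) else 0)"
| "neval J (NCell a b) m = nmem m (neval J a m) (neval J b m)"
| "neval J (NAdd a b) m = neval J a m + neval J b m"
| "neval J (NSub a b) m = neval J a m - neval J b m"

primrec reval :: "knapsack \<Rightarrow> rexp \<Rightarrow> memory \<Rightarrow> real" where
  "reval J (OfNat e) m = real (neval J e m)"
| "reval J (RCell a b) m = rmem m (neval J a m) (neval J b m)"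
| "reval J (RAdd a b) m = reval J a m + reval J b m"
| "reval J (RSub a b) m = reval J a m - reval J b m"
| "reval J (RMul a b) m = reval J a m * reval J b m"
| "reval J (RDiv a b) m = reval J a m / reval J b m"
| "reval J (Tail e) m = tail_oracle J (neval J e m)"
| "reval J (Value e) m = val J {i \<in> item_set J. nmem m (neval J e m) i \<noteq> 0}"
| "reval J (Multilinear e) m = multilinear_oracle J (rmem m (neval J e m))"

primrec beval :: "knapsack \<Rightarrow> bexp \<Rightarrow> memory \<Rightarrow> bool" where
  "beval J (NLess a b) m \<longleftrightarrow> neval J a m < neval J b m"
| "beval J (RLess a b) m \<longleftrightarrow> reval J a m < reval J b m"
| "beval J (BNot b) m \<longleftrightarrow> \<not> beval J b m"
| "beval J (BAnd a b) m \<longleftrightarrow> beval J a m \<and> beval J b m"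

definition nstore :: "nat \<Rightarrow> nat \<Rightarrow> nat \<Rightarrow> memory \<Rightarrow> memory" where
  "nstore a b v m = m\<lparr>nmem := (nmem m)(a := (nmem m a)(b := v))\<rparr>"

definition rstore :: "nat \<Rightarrow> nat \<Rightarrow> real \<Rightarrow> memory \<Rightarrow> memory" where
  "rstore a b v m = m\<lparr>rmem := (rmem m)(a := (rmem m a)(b := v))\<rparr>"

text \<open>
  A configuration consists of the commands that remain to be executed and the memory; it is final
  when no command remains. \<open>Toss\<close> stores a fair random bit. Every step costs one unit of time; as
  the expressions evaluated in a step belong to the fixed program, this is, up to a constant factor,
  the number of elementary operations and oracle queries.
\<close>

type_synonym config = "com list \<times> memory"

fun exec1 :: "knapsack \<Rightarrow> com \<Rightarrow> com list \<Rightarrow> memory \<Rightarrow> config pmf" where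
  "exec1 J Skip K m = return_pmf (K, m)"
| "exec1 J (NStore a b e) K m = return_pmf (K, nstore (neval J a m) (neval J b m) (neval J e m) m)"
| "exec1 J (RStore a b e) K m = return_pmf (K, rstore (neval J a m) (neval J b m) (reval J e m) m)"
| "exec1 J (Toss a b) K m =
     map_pmf (\<lambda>c. (K, nstore (neval J a m) (neval J b m) (of_bool c) m)) (bernoulli_pmf (1 / 2))"
| "exec1 J (Seq c d) K m = return_pmf (c # d # K, m)"
| "exec1 J (Cond b c d) K m = return_pmf ((if beval J b m then c else d) # K, m)"
| "exec1 J (Loop b c) K m = return_pmf (if beval J b m then c # Loop b c # K else K, m)"

fun step :: "knapsack \<Rightarrow> config \<Rightarrow> config pmf" where
  "step J ([], m) = return_pmf ([], m)"
| "step J (c # K, m) = exec1 J c K m"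

primrec steps :: "knapsack \<Rightarrow> nat \<Rightarrow> config \<Rightarrow> config pmf" where
  "steps J 0 cfg = return_pmf cfg"
| "steps J (Suc k) cfg = bind_pmf (step J cfg) (steps J k)"

definition run :: "knapsack \<Rightarrow> com \<Rightarrow> nat \<Rightarrow> config pmf" where
  "run J P k = steps J k ([P], \<lparr>nmem = \<lambda>_ _. 0, rmem = \<lambda>_ _. 0\<rparr>)"

text \<open>Running times are worst-case, over all outcomes of the random bits.\<close>

definition halts_within :: "com \<Rightarrow> knapsack \<Rightarrow> nat \<Rightarrow> bool" where
  "halts_within P J k \<longleftrightarrow> (\<forall>cfg\<in>set_pmf (run J P k). fst cfg = [])"

definition halts :: "com \<Rightarrow> knapsack \<Rightarrow> bool" where
  "halts P J \<longleftrightarrow> (\<exists>k. halts_within P J k)"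

definition running_time :: "com \<Rightarrow> knapsack \<Rightarrow> nat" where
  "running_time P J = (LEAST k. halts_within P J k)"

text \<open>The output sequence is left in the first \<open>n\<close> cells of row 0.\<close>

definition output_pmf :: "com \<Rightarrow> knapsack \<Rightarrow> nat list pmf" where
  "output_pmf P J =
     map_pmf (\<lambda>cfg. map (nmem (snd cfg) 0) [0..<items J]) (run J P (running_time P J))"

text \<open>Linear in \<open>T\<close>, and otherwise polynomial in the input size; the summands 1 only matter for
  the empty instance.\<close>

definition pseudo_polynomial_time :: "com \<Rightarrow> bool" where
  "pseudo_polynomial_time P \<longleftrightarrow>
     (\<exists>(c::real) (d::nat). \<forall>J. valid_instance J \<longrightarrow>
        halts P J \<and>
        real (running_time P J) \<le> c * (real (total_size J) + 1) * (input_size J + 1) ^ d)"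

text \<open>The ratio \<open>\<alpha>\<close> may depend on the instance, so that \<open>o(1)\<close> terms can be expressed.\<close>

definition approximation_algorithm :: "com \<Rightarrow> (knapsack \<Rightarrow> real) \<Rightarrow> bool" where
  "approximation_algorithm P \<alpha> \<longleftrightarrow>
     (\<forall>J. valid_instance J \<longrightarrow>
        halts P J \<and>
        set_pmf (output_pmf P J) \<subseteq> solutions J \<and>
        measure_pmf.expectation (output_pmf P J) (objective J) \<ge> \<alpha> J * opt J)"

section \<open>Basic facts\<close>

lemma packed_Nil [simp]: "packed J [] C = {}"
  by (simp add: packed_def)

lemma packed_Cons:
  "packed J (i # xs) C =
     (if size_of J i \<le> C then insert i (packed J xs (C - size_of J i)) else {})"
proof (cases "size_of J i \<le> C")
  case False
  have "(GREATEST k. k \<le> length (i # xs) \<and> fits J (take k (i # xs)) C) = 0"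
  proof (rule Greatest_equality)
    fix k assume "k \<le> length (i # xs) \<and> fits J (take k (i # xs)) C"
    then show "k \<le> 0" using False by (cases k) (auto simp: fits_def)
  qed (simp add: fits_def)
  then show ?thesis using False unfolding packed_def by simp
next
  case True
  define Q where "Q = (\<lambda>k. k \<le> length xs \<and> fits J (take k xs) (C - size_of J i))"
  have Q0: "Q 0" by (simp add: Q_def fits_def)
  have bound: "\<And>k. Q k \<Longrightarrow> k \<le> length xs" by (simp add: Q_def)
  have eq: "k \<le> length (i # xs) \<and> fits J (take k (i # xs)) C \<longleftrightarrow>
      k = 0 \<or> (\<exists>l. k = Suc l \<and> Q l)" for k
    using True by (cases k) (auto simp: Q_def fits_def)
  have "(GREATEST k. k \<le> length (i # xs) \<and> fits J (take k (i # xs)) C) = Suc (GREATEST k. Q k)"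
    unfolding eq
  proof (rule Greatest_equality)
    show "Suc (GREATEST k. Q k) = 0 \<or> (\<exists>l. Suc (GREATEST k. Q k) = Suc l \<and> Q l)"
      using GreatestI_nat[of Q, OF Q0 bound] by simp
  next
    fix k assume "k = 0 \<or> (\<exists>l. k = Suc l \<and> Q l)"
    then show "k \<le> Suc (GREATEST k. Q k)"
      using Greatest_le_nat[of Q, OF _ bound] by auto
  qed
  then show ?thesis using True unfolding packed_def Q_def by simp
qed

lemma finite_solutions: "finite (solutions J)"
  by (simp add: solutions_def item_set_def)

lemma solutions_nonempty: "solutions J \<noteq> {}"
  by (simp add: solutions_def item_set_def)

lemma steps_add: "steps J (k + l) cfg = bind_pmf (steps J k cfg) (steps J l)"
proof (induction k arbitrary: cfg)
  case (Suc k)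
  then have "steps J (k + l) = (\<lambda>x. bind_pmf (steps J k x) (steps J l))" by blast
  then show ?case by (simp add: bind_assoc_pmf)
qed (simp add: bind_return_pmf)

lemma steps_final: "steps J k ([], m) = return_pmf ([], m)"
  by (induction k) (simp_all add: bind_return_pmf)

lemma run_stable:
  assumes "halts_within P J k" "k \<le> l"
  shows "run J P l = run J P k"
proof -
  have "run J P l = bind_pmf (run J P k) (steps J (l - k))"
    using steps_add[of J k "l - k"] assms(2) by (simp add: run_def)
  also have "\<dots> = bind_pmf (run J P k) return_pmf"
  proof (rule bind_pmf_cong)
    fix cfg assume "cfg \<in> set_pmf (run J P k)"
    then have "fst cfg = []" using assms(1) by (simp add: halts_within_def)
    then show "steps J (l - k) cfg = return_pmf cfg"
      by (metis steps_final prod.collapse)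
  qed simp
  finally show ?thesis by (simp add: bind_return_pmf')
qed

end

theory Submission
  imports Defs
begin

text \<open>
  The algorithm maintains a schedule of pairwise disjoint time intervals in \<open>[0, T)\<close>, one per
  scheduled item, and values it by the expected \<open>f\<close>-value of the items whose interval ends by time
  \<open>C\<close>. In each round, the possible intervals whose start is not covered by the schedule get their
  marginal gain as weight; dynamic programming over time yields disjoint intervals
  \<open>e\<^sub>0, \<dots>, e\<^sub>k\<close> with \<open>k < n\<close> of maximum total weight \<open>W\<close>, and for \<open>r\<close> uniform in
  \<open>{0, \<dots>, N - 1}\<close>, \<open>N \<ge> n\<close>, the interval \<open>e\<^sub>r\<close> (if any) is added, evicting the intervals whose
  start it covers. Let \<open>Q\<close> be the items of an optimal sequence whose start there has never been
  covered by an added interval, and \<open>\<Psi>\<close> the marginal gain of adding all their intervals, ignoring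
  overlaps, to the schedule, whose value is \<open>g\<close>. Every point of time is covered by at most one
  \<open>e\<^sub>r\<close>, so a round changes the expectations, with \<open>\<delta> = 1/N\<close>, to
  \<open>g' \<ge> (1 - \<delta>) g + \<delta> W\<close> and \<open>\<Psi>' \<ge> (1 - \<delta>) \<Psi> - \<delta> W\<close>, while \<open>W \<ge> \<Psi>\<close> by
  submodularity. With \<open>u = 1 - \<delta>\<close>, the value after \<open>k\<close> rounds is thus at least
  \<open>(u\<^sup>k - (2u - 1)\<^sup>k) OPT\<close>, which is at least \<open>OPT/4\<close> for the least \<open>k\<close> with
  \<open>u\<^sup>k \<le> 1/2\<close>; no \<open>o(1)\<close> loss remains, and the multilinear oracle is not needed.
\<close>

section \<open>Schedules and their improvement\<close>

text \<open>A schedule maps items to start times; unscheduled items get the start time \<open>T\<close>, so that they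
  end after \<open>T\<close> because sizes are positive.\<close>

definition completed :: "knapsack \<Rightarrow> (nat \<Rightarrow> nat) \<Rightarrow> nat \<Rightarrow> nat set" where
  "completed J \<sigma> \<tau> = {i \<in> item_set J. \<sigma> i + size_of J i \<le> \<tau>}"

definition plan_value :: "knapsack \<Rightarrow> (nat \<Rightarrow> nat) \<Rightarrow> real" where
  "plan_value J \<sigma> = (\<Sum>\<tau>\<le>total_size J. pmf (cap J) \<tau> * val J (completed J \<sigma> \<tau>))"

text \<open>Unscheduled items start at \<open>total_size J\<close> and cover no point below it,
  while the start of any interval that ends by \<open>total_size J\<close> lies below it.\<close>

definition covered :: "knapsack \<Rightarrow> (nat \<Rightarrow> nat) \<Rightarrow> nat \<Rightarrow> bool" where
  "covered J \<sigma> t \<longleftrightarrow> (\<exists>j\<in>item_set J. \<sigma> j \<le> t \<and> t < \<sigma> j + size_of J j)"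

definition marginal :: "knapsack \<Rightarrow> (nat \<Rightarrow> nat) \<Rightarrow> nat \<Rightarrow> nat \<Rightarrow> real" where
  "marginal J \<sigma> i \<tau> = val J (insert i (completed J \<sigma> \<tau>)) - val J (completed J \<sigma> \<tau>)"

text \<open>A new interval evicts only the intervals that start inside it, so it must not begin
  inside another one; weight 0 on covered starts enforces this. The sum ignores evictions, whose
  cost is accounted for through \<open>hit\<close>.\<close>

definition gain :: "knapsack \<Rightarrow> (nat \<Rightarrow> nat) \<Rightarrow> nat \<Rightarrow> nat \<Rightarrow> real" where
  "gain J \<sigma> i c =
     (if size_of J i \<le> c \<and> \<not> covered J \<sigma> (c - size_of J i)
      then \<Sum>\<tau>=c..total_size J. pmf (cap J) \<tau> * marginal J \<sigma> i \<tau> else 0)"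

text \<open>The new interval ends last and gets index \<open>k\<close>, above all indices of the
  smaller layer, so that indices follow the order in time. If the difference in \<open>a\<close> is
  truncated, the guard discards the result.\<close>

definition improve ::
    "knapsack \<Rightarrow> (nat \<Rightarrow> nat \<Rightarrow> real) \<Rightarrow> nat \<Rightarrow> nat \<Rightarrow>
     (nat \<Rightarrow> real \<times> (nat \<Rightarrow> (nat \<times> nat) option)) \<Rightarrow> nat \<Rightarrow>
     real \<times> (nat \<Rightarrow> (nat \<times> nat) option) \<Rightarrow> real \<times> (nat \<Rightarrow> (nat \<times> nat) option)" where
  "improve J w k t prev i b =
     (let a = prev (t - size_of J i) in
      if size_of J i \<le> t \<and> fst b < fst a + w i t
      then (fst a + w i t, (snd a)(k := Some (i, t))) else b)"

text \<open>Intervals are represented as pairs of an item and an end time. \<open>best J w k t\<close> packs at most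
  \<open>k\<close> of them into \<open>[0, t)\<close>. Without the bound on their number, copies of one item could collect most
  of the weight although only the first one is worth anything.\<close>

fun best :: "knapsack \<Rightarrow> (nat \<Rightarrow> nat \<Rightarrow> real) \<Rightarrow> nat \<Rightarrow> nat \<Rightarrow>
    real \<times> (nat \<Rightarrow> (nat \<times> nat) option)" where
  "best J w 0 t = (0, \<lambda>_. None)"
| "best J w (Suc k) 0 = (0, \<lambda>_. None)"
| "best J w (Suc k) (Suc t) =
     fold (improve J w k (Suc t) (\<lambda>t'. best J w k t')) [0..<items J] (best J w (Suc k) t)"

text \<open>Eviction is a restart at \<open>total_size J\<close>; an item scheduled elsewhere simply
  moves. Indices outside the item set keep their value, so that the function agrees with a whole
  memory row of the program.\<close>

definition reschedule :: "knapsack \<Rightarrow> (nat \<Rightarrow> nat) \<Rightarrow> nat \<Rightarrow> nat \<Rightarrow> nat \<Rightarrow> nat" where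
  "reschedule J \<sigma> i c j =
     (if j = i then c - size_of J i
      else if j \<in> item_set J \<and> c - size_of J i \<le> \<sigma> j \<and> \<sigma> j < c then total_size J else \<sigma> j)"

abbreviation picks :: "knapsack \<Rightarrow> (nat \<Rightarrow> nat) \<Rightarrow> nat \<Rightarrow> (nat \<times> nat) option" where
  "picks J \<sigma> \<equiv> snd (best J (gain J \<sigma>) (items J) (total_size J))"

text \<open>A positive gain guarantees an uncovered start and a move of the item to an earlier start
  (\<open>gain_pos\<close>). Draws \<open>r\<close> without a pick change nothing, which lets the
  range of \<open>r\<close> be a power of two.\<close>

definition advance :: "knapsack \<Rightarrow> (nat \<Rightarrow> nat) \<Rightarrow> nat \<Rightarrow> nat \<Rightarrow> nat" where
  "advance J \<sigma> r =
     (case picks J \<sigma> r of None \<Rightarrow> \<sigma>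
      | Some (i, c) \<Rightarrow> if 0 < gain J \<sigma> i c then reschedule J \<sigma> i c else \<sigma>)"

primrec chain :: "knapsack \<Rightarrow> nat \<Rightarrow> nat \<Rightarrow> (nat \<Rightarrow> nat) \<Rightarrow> (nat \<Rightarrow> nat) pmf" where
  "chain J N 0 \<sigma> = return_pmf \<sigma>"
| "chain J N (Suc k) \<sigma> = bind_pmf (pmf_of_set {..<N}) (\<lambda>r. chain J N k (advance J \<sigma> r))"

definition packing :: "knapsack \<Rightarrow> nat \<Rightarrow> nat \<Rightarrow> (nat \<Rightarrow> (nat \<times> nat) option) \<Rightarrow> bool" where
  "packing J k t B \<longleftrightarrow>
     (\<forall>r i c. B r = Some (i, c) \<longrightarrow> r < k \<and> i \<in> item_set J \<and> size_of J i \<le> c \<and> c \<le> t) \<and>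
     (\<forall>r r' i c i' c'. r < r' \<longrightarrow> B r = Some (i, c) \<longrightarrow> B r' = Some (i', c') \<longrightarrow>
        c \<le> c' - size_of J i')"

definition weight :: "(nat \<Rightarrow> nat \<Rightarrow> real) \<Rightarrow> (nat \<times> nat) option \<Rightarrow> real" where
  "weight w e = (case e of None \<Rightarrow> 0 | Some (i, c) \<Rightarrow> w i c)"

section \<open>Correctness of the dynamic program\<close>

lemma packing_mono: "packing J k t B \<Longrightarrow> k \<le> k' \<Longrightarrow> t \<le> t' \<Longrightarrow> packing J k' t' B"
  unfolding packing_def by (meson le_trans less_le_trans)

lemma packing_improve:
  assumes a: "packing J k (t - size_of J i) B" "size_of J i \<le> t" "i \<in> item_set J"
  shows "packing J (Suc k) t (B(k := Some (i, t)))"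
  unfolding packing_def
proof (intro conjI allI impI)
  fix r i' c' assume "(B(k := Some (i, t))) r = Some (i', c')"
  then show "r < Suc k" "i' \<in> item_set J" "size_of J i' \<le> c'" "c' \<le> t"
    using assms by (cases "r = k"; fastforce simp: packing_def)+
next
  fix r r' i1 c1 i2 c2
  assume r: "r < r'" "(B(k := Some (i, t))) r = Some (i1, c1)"
    "(B(k := Some (i, t))) r' = Some (i2, c2)"
  have "r' \<le> k" using r(3) a(1) by (cases "r' = k") (auto simp: packing_def intro: less_imp_le)
  then have B: "B r = Some (i1, c1)" using r by auto
  show "c1 \<le> c2 - size_of J i2"
  proof (cases "r' = k")
    case True
    then show ?thesis using r(3) B a(1) by (auto simp: packing_def)
  next
    case False
    then show ?thesis using r(1,3) B a(1) by (fastforce simp: packing_def)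
  qed
qed

text \<open>Soundness of the table: its values are attained by the stored packings. Optimality is
  proved only against sequences of the items, in \<open>gains_le_best\<close>.\<close>

lemma best_packing:
  "packing J k t (snd (best J w k t)) \<and>
   fst (best J w k t) = (\<Sum>r<k. weight w (snd (best J w k t) r))"
proof (induction J w k t rule: best.induct)
  case (3 J w k t)
  let ?P = "\<lambda>b. packing J (Suc k) (Suc t) (snd b) \<and> fst b = (\<Sum>r<Suc k. weight w (snd b r))"
  show ?case unfolding best.simps
  proof (rule fold_invariant[where Q = "\<lambda>i. i \<in> item_set J" and P = ?P])
    show "?P (best J w (Suc k) t)"
      using "3.IH"(1) packing_mono[of J "Suc k" t _ "Suc k" "Suc t"] by simp
  next
    fix i b assume i: "i \<in> item_set J" and b: "?P b"
    let ?a = "best J w k (Suc t - size_of J i)"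
    have a: "packing J k (Suc t - size_of J i) (snd ?a)"
      "fst ?a = (\<Sum>r<k. weight w (snd ?a r))"
      using "3.IH"(2) i by (auto simp: item_set_def)
    have "(\<Sum>r<Suc k. weight w (((snd ?a)(k := Some (i, Suc t))) r)) =
        (\<Sum>r<k. weight w (snd ?a r)) + w i (Suc t)"
      by (auto simp: weight_def intro!: sum.cong)
    then show "?P (improve J w k (Suc t) (best J w k) i b)"
      using b i a packing_improve[OF a(1) _ i]
      by (auto simp: improve_def Let_def)
  qed (auto simp: item_set_def)
qed (auto simp: packing_def weight_def)

lemma fold_improve_ge:
  "fst b \<le> fst (fold (improve J w k t prev) is b)"
proof (induction "is" arbitrary: b)
  case (Cons i xs)
  have "fst b \<le> fst (improve J w k t prev i b)" by (simp add: improve_def Let_def)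
  also note Cons.IH
  finally show ?case by simp
qed simp

lemma fold_improve_ge_item:
  assumes "i \<in> set is" "size_of J i \<le> t"
  shows "fst (prev (t - size_of J i)) + w i t \<le> fst (fold (improve J w k t prev) is b)"
  using assms(1)
proof (induction "is" arbitrary: b)
  case (Cons x xs)
  show ?case
  proof (cases "i = x")
    case True
    have "fst (prev (t - size_of J i)) + w i t \<le> fst (improve J w k t prev x b)"
      using True assms(2) by (auto simp: improve_def Let_def)
    then show ?thesis using fold_improve_ge[of "improve J w k t prev x b" J w k t prev xs] by simp
  qed (use Cons in auto)
qed simp

text \<open>The recursion read as a lower bound: appending an interval costs one layer. A positive
  size forces \<open>t\<close> to be nonzero, so that the third equation of \<open>best\<close>
  applies.\<close>

lemma best_extend:
  assumes "i \<in> item_set J" "size_of J i \<le> t" "0 < size_of J i"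
  shows "fst (best J w k (t - size_of J i)) + w i t \<le> fst (best J w (Suc k) t)"
proof -
  obtain t' where "t = Suc t'" using assms(2,3) by (cases t) auto
  then show ?thesis
    using assms fold_improve_ge_item[of i "[0..<items J]" J t "best J w k" w k]
    by (simp add: item_set_def)
qed

section \<open>Inequalities for submodular functions\<close>

lemma submodular_diminishing:
  assumes "submodular_on I f" "X \<subseteq> Z" "Z \<subseteq> I" "Y \<subseteq> I" "mono_on (Pow I) f"
  shows "f (Z \<union> Y) - f Z \<le> f (X \<union> Y) - f X"
proof -
  have "f (Z \<union> (X \<union> Y)) + f (Z \<inter> (X \<union> Y)) \<le> f Z + f (X \<union> Y)"
    using assms unfolding submodular_on_def by (metis Un_least order_trans)
  \<comment> \<open>\<open>Y\<close> may meet \<open>Z\<close>, which can make this intersection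
    larger than \<open>X\<close>; monotonicity absorbs the difference.\<close>
  moreover have "f X \<le> f (Z \<inter> (X \<union> Y))"
    using assms by (intro mono_onD[OF assms(5)]) auto
  moreover have "Z \<union> (X \<union> Y) = Z \<union> Y" using assms by auto
  ultimately show ?thesis by simp
qed

text \<open>When disjoint sets are deleted, the two remainders have union \<open>X\<close>, and
  their intersection is the joint remainder, so submodularity makes losses superadditive. This
  bounds the total loss by evictions over all draws.\<close>

lemma submodular_disjoint_losses:
  assumes f: "submodular_on I f" and X: "X \<subseteq> I" and "finite R"
    and "\<And>r r'. r \<in> R \<Longrightarrow> r' \<in> R \<Longrightarrow> r \<noteq> r' \<Longrightarrow> E r \<inter> E r' = {}"
  shows "(\<Sum>r\<in>R. f X - f (X - E r)) \<le> f X - f (X - (\<Union>r\<in>R. E r))"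
  using assms(3,4)
proof (induction R rule: finite_induct)
  case (insert r R)
  let ?U = "\<Union>r\<in>R. E r"
  have disj: "E r \<inter> ?U = {}" using insert.hyps insert.prems by blast
  have "(X - E r) \<union> (X - ?U) = X" "(X - E r) \<inter> (X - ?U) = X - (\<Union>r\<in>insert r R. E r)"
    using disj by auto
  then have "f X + f (X - (\<Union>r\<in>insert r R. E r)) \<le> f (X - E r) + f (X - ?U)"
    using f X unfolding submodular_on_def by (metis Diff_subset order_trans)
  moreover have "(\<Sum>r\<in>R. f X - f (X - E r)) \<le> f X - f (X - ?U)"
    using insert by auto
  ultimately show ?case using insert.hyps by simp
qed simp

lemma submodular_sum_marginals:
  assumes f: "submodular_on I f" "mono_on (Pow I) f" and X: "X \<subseteq> I" and "finite Y" "Y \<subseteq> I"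
  shows "f (X \<union> Y) - f X \<le> (\<Sum>i\<in>Y. f (insert i X) - f X)"
  using assms(4,5)
proof (induction Y rule: finite_induct)
  case (insert i Y)
  have "f ((X \<union> Y) \<union> {i}) - f (X \<union> Y) \<le> f (X \<union> {i}) - f X"
    using insert X by (intro submodular_diminishing[OF f(1)] f(2)) auto
  then show ?case using insert by simp
qed simp

section \<open>From schedules to sequences\<close>

lemma packed_eq:
  "packed J xs C =
     {i \<in> set xs. sum_list (map (size_of J) (takeWhile (\<lambda>j. j \<noteq> i) xs)) + size_of J i \<le> C}"
proof (induction xs arbitrary: C)
  case (Cons x xs)
  show ?case
    by (auto simp: packed_Cons Cons.IH)
qed simp

definition prefix_plan :: "knapsack \<Rightarrow> nat list \<Rightarrow> nat \<Rightarrow> nat" where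
  "prefix_plan J xs i = sum_list (map (size_of J) (takeWhile (\<lambda>j. j \<noteq> i) xs))"

text \<open>Requiring the later start to be below \<open>total_size J\<close> exempts every pair
  with an unscheduled item; in particular, unscheduled items may share their start.\<close>

definition feasible :: "knapsack \<Rightarrow> (nat \<Rightarrow> nat) \<Rightarrow> bool" where
  "feasible J \<sigma> \<longleftrightarrow>
     (\<forall>i\<in>item_set J. \<sigma> i \<le> total_size J) \<and>
     (\<forall>i\<in>item_set J. \<forall>j\<in>item_set J. i \<noteq> j \<longrightarrow> \<sigma> i \<le> \<sigma> j \<longrightarrow> \<sigma> j < total_size J \<longrightarrow>
        \<sigma> i + size_of J i \<le> \<sigma> j)"

text \<open>A counting sort by start time, written in the order in which the nested loops of
  \<open>emit\<close> visit the pairs. The last bucket of \<open>bucket_sort\<close> holds the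
  unscheduled items.\<close>

definition bucket_prefix :: "knapsack \<Rightarrow> (nat \<Rightarrow> nat) \<Rightarrow> nat \<Rightarrow> nat list" where
  "bucket_prefix J \<sigma> m = concat (map (\<lambda>t. filter (\<lambda>i. \<sigma> i = t) [0..<items J]) [0..<m])"

abbreviation bucket_sort :: "knapsack \<Rightarrow> (nat \<Rightarrow> nat) \<Rightarrow> nat list" where
  "bucket_sort J \<sigma> \<equiv> bucket_prefix J \<sigma> (Suc (total_size J))"

lemma bucket_prefix:
  "set (bucket_prefix J \<sigma> m) = {i \<in> item_set J. \<sigma> i < m} \<and> distinct (bucket_prefix J \<sigma> m) \<and>
   sorted (map \<sigma> (bucket_prefix J \<sigma> m))"
proof (induction m)
  case (Suc m)
  have "bucket_prefix J \<sigma> (Suc m) = bucket_prefix J \<sigma> m @ filter (\<lambda>i. \<sigma> i = m) [0..<items J]"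
    by (simp add: bucket_prefix_def)
  moreover have "sorted (map \<sigma> (filter (\<lambda>i. \<sigma> i = m) [0..<items J]))"
  proof -
    have "map \<sigma> (filter (\<lambda>i. \<sigma> i = m) [0..<items J]) =
        replicate (length (filter (\<lambda>i. \<sigma> i = m) [0..<items J])) m"
      by (rule replicate_eqI) auto
    then show ?thesis by simp
  qed
  ultimately show ?case
    using Suc by (auto simp: sorted_append item_set_def less_Suc_eq)
qed (simp add: bucket_prefix_def)

lemma bucket_sort_solution:
  assumes "feasible J \<sigma>"
  shows "bucket_sort J \<sigma> \<in> solutions J"
  using bucket_prefix[of J \<sigma> "Suc (total_size J)"] assms
  by (auto simp: solutions_def permutations_of_set_def feasible_def less_Suc_eq_le)

locale valid_knapsack =
  fixes J :: knapsack
  assumes valid: "valid_instance J"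
begin

lemma finite_items [simp]: "finite (item_set J)" by (simp add: item_set_def)

lemma size_pos: "i \<in> item_set J \<Longrightarrow> 0 < size_of J i"
  using valid by (simp add: valid_instance_def)

lemma val_nonneg: "X \<subseteq> item_set J \<Longrightarrow> 0 \<le> val J X"
  using valid by (simp add: valid_instance_def)

lemma val_empty: "val J {} = 0"
  using valid by (simp add: valid_instance_def)

lemma val_mono_on: "mono_on (Pow (item_set J)) (val J)"
  using valid by (simp add: valid_instance_def)

lemma val_mono: "X \<subseteq> Y \<Longrightarrow> Y \<subseteq> item_set J \<Longrightarrow> val J X \<le> val J Y"
  by (rule mono_onD[OF val_mono_on]) auto

lemma val_submodular: "submodular_on (item_set J) (val J)"
  using valid by (simp add: valid_instance_def)

lemma completed_subset: "completed J \<sigma> \<tau> \<subseteq> item_set J"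
  by (auto simp: completed_def)

lemma expectation_cap:
  "measure_pmf.expectation (cap J) h = (\<Sum>\<tau>\<le>total_size J. pmf (cap J) \<tau> * h \<tau>)"
proof -
  have "set_pmf (cap J) \<subseteq> {..total_size J}" using valid by (auto simp: valid_instance_def)
  then show ?thesis
    by (subst integral_measure_pmf[of "{..total_size J}"]) (auto simp: mult.commute)
qed

lemma objective_prefix_plan:
  assumes "xs \<in> solutions J"
  shows "objective J xs = plan_value J (prefix_plan J xs)"
proof -
  have "set xs = item_set J" using assms by (simp add: solutions_def permutations_of_set_def)
  then show ?thesis
    by (simp add: objective_def expectation_cap plan_value_def packed_eq completed_def
        prefix_plan_def)
qed

text \<open>The predecessors of \<open>i\<close> in the sorted sequence occupy disjoint intervals
  that all end by \<open>\<sigma> i\<close>, so their total size is at most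
  \<open>\<sigma> i\<close>: reading off the order only removes idle time.\<close>

lemma prefix_plan_le:
  assumes f: "feasible J \<sigma>" and i: "i \<in> item_set J" "\<sigma> i < total_size J"
  shows "prefix_plan J (bucket_sort J \<sigma>) i \<le> \<sigma> i"
proof -
  let ?xs = "bucket_sort J \<sigma>"
  let ?ys = "takeWhile (\<lambda>j. j \<noteq> i) ?xs"
  have xs: "set ?xs = item_set J" "distinct ?xs" "sorted (map \<sigma> ?xs)"
    using bucket_prefix[of J \<sigma> "Suc (total_size J)"] f
    by (auto simp: feasible_def less_Suc_eq_le)
  have ys: "j \<in> item_set J \<and> j \<noteq> i \<and> \<sigma> j \<le> \<sigma> i" if "j \<in> set ?ys" for j
  proof -
    have "i \<in> set (dropWhile (\<lambda>j. j \<noteq> i) ?xs)"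
      using i(1) xs(1) by (metis (mono_tags, lifting) dropWhile_eq_Nil_conv hd_dropWhile list.set_sel(1))
    moreover have "sorted (map \<sigma> ?ys @ map \<sigma> (dropWhile (\<lambda>j. j \<noteq> i) ?xs))"
      using xs(3) by (metis map_append takeWhile_dropWhile_id)
    ultimately show ?thesis
      using that set_takeWhileD[OF that] xs(1) by (auto simp: sorted_append)
  qed
  have dj: "distinct ?ys" using xs(2) by (rule distinct_takeWhile)
  have sep: "\<sigma> j + size_of J j \<le> \<sigma> k"
    if "j \<in> item_set J" "k \<in> item_set J" "j \<noteq> k" "\<sigma> j \<le> \<sigma> k" "\<sigma> k \<le> \<sigma> i" for j k
    using f i that by (auto simp: feasible_def)
  have "prefix_plan J ?xs i = (\<Sum>j\<in>set ?ys. size_of J j)"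
    by (simp add: prefix_plan_def sum_list_distinct_conv_sum_set[OF dj])
  \<comment> \<open>Sizes become cardinalities of intervals, so that disjointness turns the sum into
    the cardinality of a union.\<close>
  also have "\<dots> = (\<Sum>j\<in>set ?ys. card {\<sigma> j..<\<sigma> j + size_of J j})" by simp
  also have "\<dots> = card (\<Union>j\<in>set ?ys. {\<sigma> j..<\<sigma> j + size_of J j})"
  proof (rule card_UN_disjoint[symmetric])
    show "\<forall>j\<in>set ?ys. \<forall>k\<in>set ?ys. j \<noteq> k \<longrightarrow>
        {\<sigma> j..<\<sigma> j + size_of J j} \<inter> {\<sigma> k..<\<sigma> k + size_of J k} = {}"
    proof (intro ballI impI)
      fix j k assume jk: "j \<in> set ?ys" "k \<in> set ?ys" "j \<noteq> k"
      then have "\<sigma> j + size_of J j \<le> \<sigma> k \<or> \<sigma> k + size_of J k \<le> \<sigma> j"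
        using sep[of j k] sep[of k j] ys[of j] ys[of k] linear[of "\<sigma> j" "\<sigma> k"] by auto
      then show "{\<sigma> j..<\<sigma> j + size_of J j} \<inter> {\<sigma> k..<\<sigma> k + size_of J k} = {}" by auto
    qed
  qed auto
  also have "\<dots> \<le> card {..<\<sigma> i}"
  proof (rule card_mono)
    show "(\<Union>j\<in>set ?ys. {\<sigma> j..<\<sigma> j + size_of J j}) \<subseteq> {..<\<sigma> i}"
      using ys sep[of _ i] i by fastforce
  qed simp
  finally show ?thesis by simp
qed

text \<open>Completion times only move forward in the sorted sequence. Items at
  \<open>total_size J\<close> complete at no relevant capacity under \<open>\<sigma>\<close>, so
  that nothing has to be shown for them.\<close>

lemma plan_value_le_objective:
  assumes f: "feasible J \<sigma>"
  shows "plan_value J \<sigma> \<le> objective J (bucket_sort J \<sigma>)"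
proof -
  have "completed J \<sigma> \<tau> \<subseteq> completed J (prefix_plan J (bucket_sort J \<sigma>)) \<tau>"
    if "\<tau> \<le> total_size J" for \<tau>
    using prefix_plan_le[OF f] size_pos that by (fastforce simp: completed_def)
  then show ?thesis
    unfolding objective_prefix_plan[OF bucket_sort_solution[OF f]] plan_value_def
    by (intro sum_mono mult_left_mono val_mono completed_subset) auto
qed

section \<open>Change of the potentials in one round\<close>

lemma gain_pos:
  assumes "0 < gain J \<sigma> i c" and i: "i \<in> item_set J"
  shows "size_of J i \<le> c" "\<not> covered J \<sigma> (c - size_of J i)" "c - size_of J i < \<sigma> i"
    "gain J \<sigma> i c = (\<Sum>\<tau>=c..total_size J. pmf (cap J) \<tau> * marginal J \<sigma> i \<tau>)"
proof -
  show *: "size_of J i \<le> c" "\<not> covered J \<sigma> (c - size_of J i)"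
    "gain J \<sigma> i c = (\<Sum>\<tau>=c..total_size J. pmf (cap J) \<tau> * marginal J \<sigma> i \<tau>)"
    using assms by (auto simp: gain_def split: if_splits)
  \<comment> \<open>If \<open>i\<close> already started no later, it would be completed at every
    time from \<open>c\<close> on, and all its marginals in the sum would vanish.\<close>
  show "c - size_of J i < \<sigma> i"
  proof (rule ccontr)
    assume "\<not> ?thesis"
    then have "i \<in> completed J \<sigma> \<tau>" if "c \<le> \<tau>" for \<tau>
      using that i *(1) by (auto simp: completed_def)
    then have "gain J \<sigma> i c = 0"
      unfolding *(3) by (intro sum.neutral) (auto simp: marginal_def insert_absorb)
    then show False using assms by simp
  qed
qed

lemma marginal_nonneg: "i \<in> item_set J \<Longrightarrow> 0 \<le> marginal J \<sigma> i \<tau>"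
  unfolding marginal_def using val_mono[of "completed J \<sigma> \<tau>" "insert i (completed J \<sigma> \<tau>)"]
    completed_subset by auto

lemma gain_nonneg: "i \<in> item_set J \<Longrightarrow> 0 \<le> gain J \<sigma> i c"
  unfolding gain_def by (auto intro!: sum_nonneg mult_nonneg_nonneg marginal_nonneg)

text \<open>Used with two schedules \<open>\<rho>\<close>: for \<open>\<rho> = \<sigma>\<close>
  these are the evicted items, for the schedule of an optimal sequence they are the items that leave
  \<open>Q\<close>.\<close>

definition hit :: "(nat \<Rightarrow> nat) \<Rightarrow> (nat \<Rightarrow> nat) \<Rightarrow> nat \<Rightarrow> nat set" where
  "hit \<sigma> \<rho> r =
     (case picks J \<sigma> r of None \<Rightarrow> {}
      | Some (i, c) \<Rightarrow> if 0 < gain J \<sigma> i c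
          then {j \<in> item_set J. c - size_of J i \<le> \<rho> j \<and> \<rho> j < c} else {})"

text \<open>The contribution of a single capacity to the weight of pick \<open>r\<close>. Splitting
  by capacity allows submodularity to be applied pointwise; \<open>sum_hit_marginal\<close>
  reassembles the weight.\<close>

definition hit_marginal :: "(nat \<Rightarrow> nat) \<Rightarrow> nat \<Rightarrow> nat \<Rightarrow> real" where
  "hit_marginal \<sigma> r \<tau> =
     (case picks J \<sigma> r of None \<Rightarrow> 0
      | Some (i, c) \<Rightarrow> if 0 < gain J \<sigma> i c \<and> c \<le> \<tau> then marginal J \<sigma> i \<tau> else 0)"

lemma picksD:
  assumes "picks J \<sigma> r = Some (i, c)"
  shows "r < items J" "i \<in> item_set J" "size_of J i \<le> c" "c \<le> total_size J"
  using best_packing[of J "items J" "total_size J" "gain J \<sigma>"] assms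
  unfolding packing_def by blast+

lemma picks_disjoint:
  assumes "picks J \<sigma> r = Some (i, c)" "picks J \<sigma> r' = Some (i', c')" "r < r'"
  shows "c \<le> c' - size_of J i'"
  using best_packing[of J "items J" "total_size J" "gain J \<sigma>"] assms
  unfolding packing_def by blast

lemma hit_disjoint:
  assumes "r \<noteq> r'"
  shows "hit \<sigma> \<rho> r \<inter> hit \<sigma> \<rho> r' = {}"
proof -
  have "hit \<sigma> \<rho> r \<inter> hit \<sigma> \<rho> r' = {}" if "r < r'" for r r'
    using picks_disjoint[OF _ _ that, of \<sigma>]
    by (fastforce simp: hit_def split: option.splits if_splits)
  then show ?thesis using assms by (metis Int_commute nat_neq_iff)
qed

lemma sum_hit_marginal:
  "(\<Sum>\<tau>\<le>total_size J. pmf (cap J) \<tau> * hit_marginal \<sigma> r \<tau>) = weight (gain J \<sigma>) (picks J \<sigma> r)"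
proof (cases "picks J \<sigma> r")
  case None
  then show ?thesis by (simp add: hit_marginal_def weight_def)
next
  case (Some e)
  obtain i c where e: "e = (i, c)" by force
  have i: "i \<in> item_set J" using picksD Some e by blast
  show ?thesis
  proof (cases "0 < gain J \<sigma> i c")
    case True
    have "(\<Sum>\<tau>\<le>total_size J. pmf (cap J) \<tau> * hit_marginal \<sigma> r \<tau>) =
        (\<Sum>\<tau>=c..total_size J. pmf (cap J) \<tau> * marginal J \<sigma> i \<tau>)"
      using Some e True by (intro sum.mono_neutral_cong_right) (auto simp: hit_marginal_def)
    then show ?thesis using gain_pos(4)[OF True i] Some e by (simp add: weight_def)
  next
    case False
    then show ?thesis
      using gain_nonneg[OF i, of \<sigma> c] Some e by (simp add: hit_marginal_def weight_def)
  qed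
qed

lemma sum_weight_picks:
  assumes "items J \<le> N"
  shows "(\<Sum>r<N. weight (gain J \<sigma>) (picks J \<sigma> r)) = fst (best J (gain J \<sigma>) (items J) (total_size J))"
  using best_packing[of J "items J" "total_size J" "gain J \<sigma>"] assms picksD(1)[of \<sigma>]
  by (auto intro!: sum.mono_neutral_right simp: weight_def split: option.splits)

text \<open>\<open>E\<close> holds the new item if its interval has ended by \<open>\<tau>\<close>,
  and is empty otherwise. Moving the item loses nothing: its old interval, if any, ended later, so
  whenever that one was completed the new one is too.\<close>

lemma completed_advance:
  assumes \<tau>: "\<tau> \<le> total_size J"
  obtains E where "E \<subseteq> item_set J"
    "completed J (advance J \<sigma> r) \<tau> = (completed J \<sigma> \<tau> - hit \<sigma> \<sigma> r) \<union> E"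
    "hit_marginal \<sigma> r \<tau> = val J (completed J \<sigma> \<tau> \<union> E) - val J (completed J \<sigma> \<tau>)"
proof (cases "\<exists>i c. picks J \<sigma> r = Some (i, c) \<and> 0 < gain J \<sigma> i c")
  case False
  then have "advance J \<sigma> r = \<sigma>" "hit \<sigma> \<sigma> r = {}" "hit_marginal \<sigma> r \<tau> = 0"
    by (auto simp: advance_def hit_def hit_marginal_def split: option.splits)
  then show ?thesis by (intro that[of "{}"]) auto
next
  case True
  then obtain i c where p: "picks J \<sigma> r = Some (i, c)" and pos: "0 < gain J \<sigma> i c" by auto
  note i = picksD[OF p] and g = gain_pos[OF pos picksD(2)[OF p]]
  let ?E = "if c \<le> \<tau> then {i} else {}"
  show ?thesis
  proof (rule that[of ?E])
    \<comment> \<open>The bound on \<open>\<tau>\<close> makes evicted items incomplete, as they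
      restart at \<open>total_size J\<close> with positive size.\<close>
    show "completed J (advance J \<sigma> r) \<tau> = (completed J \<sigma> \<tau> - hit \<sigma> \<sigma> r) \<union> ?E"
      using p pos i g \<tau> size_pos
      by (auto simp: completed_def advance_def reschedule_def hit_def dest: size_pos
          split: if_splits)
  qed (use p pos i in \<open>auto simp: hit_marginal_def marginal_def\<close>)
qed

text \<open>The quantity \<open>\<Psi>\<close>, with \<open>\<rho>\<close> the schedule of an optimal sequence.\<close>

definition residual :: "(nat \<Rightarrow> nat) \<Rightarrow> (nat \<Rightarrow> nat) \<Rightarrow> nat set \<Rightarrow> real" where
  "residual \<rho> \<sigma> Q = (\<Sum>\<tau>\<le>total_size J. pmf (cap J) \<tau> *
     (val J (completed J \<sigma> \<tau> \<union> (completed J \<rho> \<tau> \<inter> Q)) - val J (completed J \<sigma> \<tau>)))"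

text \<open>The sets \<open>hit \<sigma> \<rho> r\<close> are disjoint, so the losses over all
  \<open>r\<close> add up to at most \<open>F X - F {}\<close>. \<open>F\<close> is general because
  it is used for \<open>val J\<close> and for \<open>val J\<close> shifted by a completed
  set.\<close>

lemma sum_avoid_hits:
  assumes F: "submodular_on (item_set J) F" "mono_on (Pow (item_set J)) F"
    and X: "X \<subseteq> item_set J"
  shows "(real N - 1) * F X + F {} \<le> (\<Sum>r<N. F (X - hit \<sigma> \<rho> r))"
proof -
  have "(\<Sum>r<N. F X - F (X - hit \<sigma> \<rho> r)) \<le> F X - F (X - (\<Union>r\<in>{..<N}. hit \<sigma> \<rho> r))"
    by (intro submodular_disjoint_losses[OF F(1) X]) (auto simp: hit_disjoint)
  also have "\<dots> \<le> F X - F {}"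
    using X by (simp, intro mono_onD[OF F(2)]) auto
  finally show ?thesis by (simp add: sum_subtractf algebra_simps)
qed

text \<open>The bound on \<open>g'\<close> from the overview, multiplied by
  \<open>N\<close>.\<close>

lemma sum_plan_value_advance:
  assumes N: "items J \<le> N"
  shows "(real N - 1) * plan_value J \<sigma> + fst (best J (gain J \<sigma>) (items J) (total_size J))
    \<le> (\<Sum>r<N. plan_value J (advance J \<sigma> r))"
proof -
  let ?T = "total_size J" and ?p = "pmf (cap J)"
  \<comment> \<open>By diminishing returns, the pick gains at least as much after the evictions as
    before them.\<close>
  have step: "val J (completed J \<sigma> \<tau> - hit \<sigma> \<sigma> r) + hit_marginal \<sigma> r \<tau>
      \<le> val J (completed J (advance J \<sigma> r) \<tau>)" if \<tau>: "\<tau> \<le> ?T" for \<tau> r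
  proof -
    obtain E where E: "E \<subseteq> item_set J"
      "completed J (advance J \<sigma> r) \<tau> = (completed J \<sigma> \<tau> - hit \<sigma> \<sigma> r) \<union> E"
      "hit_marginal \<sigma> r \<tau> = val J (completed J \<sigma> \<tau> \<union> E) - val J (completed J \<sigma> \<tau>)"
      using completed_advance[OF \<tau>] by metis
    show ?thesis
      using submodular_diminishing[OF val_submodular _ completed_subset E(1) val_mono_on,
          of "completed J \<sigma> \<tau> - hit \<sigma> \<sigma> r" \<sigma> \<tau>] E by auto
  qed
  have "(\<Sum>\<tau>\<le>?T. ?p \<tau> * ((real N - 1) * val J (completed J \<sigma> \<tau>))) +
      (\<Sum>r<N. \<Sum>\<tau>\<le>?T. ?p \<tau> * hit_marginal \<sigma> r \<tau>)
    \<le> (\<Sum>\<tau>\<le>?T. ?p \<tau> * (\<Sum>r<N. val J (completed J \<sigma> \<tau> - hit \<sigma> \<sigma> r))) +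
      (\<Sum>r<N. \<Sum>\<tau>\<le>?T. ?p \<tau> * hit_marginal \<sigma> r \<tau>)"
    using sum_avoid_hits[OF val_submodular val_mono_on completed_subset, of N] val_empty
    by (intro add_right_mono sum_mono mult_left_mono) auto
  also have "\<dots> = (\<Sum>r<N. \<Sum>\<tau>\<le>?T. ?p \<tau> *
      (val J (completed J \<sigma> \<tau> - hit \<sigma> \<sigma> r) + hit_marginal \<sigma> r \<tau>))"
    unfolding sum_distrib_left
    by (subst sum.swap) (simp add: sum.distrib distrib_left)
  also have "\<dots> \<le> (\<Sum>r<N. plan_value J (advance J \<sigma> r))"
    unfolding plan_value_def by (intro sum_mono mult_left_mono step) auto
  finally show ?thesis
    by (simp add: sum_hit_marginal sum_weight_picks[OF N] plan_value_def sum_distrib_left mult.left_commute)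
qed

text \<open>The bound on \<Psi>' from the overview, multiplied by \<open>N\<close>. Two effects
  lower \<Psi>: removing hit items from \<open>Q\<close>, bounded by \<open>sum_avoid_hits\<close>,
  and the pick itself, which costs at most its own weight.\<close>

lemma sum_residual_advance:
  assumes N: "items J \<le> N"
  shows "(real N - 1) * residual \<rho> \<sigma> Q - fst (best J (gain J \<sigma>) (items J) (total_size J))
    \<le> (\<Sum>r<N. residual \<rho> (advance J \<sigma> r) (Q - hit \<sigma> \<rho> r))"
proof -
  let ?T = "total_size J" and ?p = "pmf (cap J)"
  let ?X = "completed J \<sigma>" and ?Y = "\<lambda>\<tau>. completed J \<rho> \<tau> \<inter> Q"
  have step: "val J (?X \<tau> \<union> (?Y \<tau> - hit \<sigma> \<rho> r)) - val J (?X \<tau>) - hit_marginal \<sigma> r \<tau>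
      \<le> val J (completed J (advance J \<sigma> r) \<tau> \<union> (completed J \<rho> \<tau> \<inter> (Q - hit \<sigma> \<rho> r)))
        - val J (completed J (advance J \<sigma> r) \<tau>)" if \<tau>: "\<tau> \<le> ?T" for \<tau> r
  proof -
    obtain E where E: "E \<subseteq> item_set J"
      "completed J (advance J \<sigma> r) \<tau> = (?X \<tau> - hit \<sigma> \<sigma> r) \<union> E"
      "hit_marginal \<sigma> r \<tau> = val J (?X \<tau> \<union> E) - val J (?X \<tau>)"
      using completed_advance[OF \<tau>] by metis
    let ?Z = "?Y \<tau> - hit \<sigma> \<rho> r"
    \<comment> \<open>Evictions from the schedule only raise the marginal gain of \<open>?Z\<close>,
      so they can be undone here; the next fact then charges \<open>E\<close> its marginal.\<close>
    have "val J ((?X \<tau> \<union> E) \<union> ?Z) - val J (?X \<tau> \<union> E)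
        \<le> val J (completed J (advance J \<sigma> r) \<tau> \<union> ?Z) - val J (completed J (advance J \<sigma> r) \<tau>)"
      using E completed_subset[of \<sigma> \<tau>] completed_subset[of \<rho> \<tau>]
      by (intro submodular_diminishing[OF val_submodular] val_mono_on) auto
    moreover have "val J (?X \<tau> \<union> ?Z) \<le> val J ((?X \<tau> \<union> E) \<union> ?Z)"
      using E(1) completed_subset[of \<sigma> \<tau>] completed_subset[of \<rho> \<tau>]
      by (intro val_mono) auto
    moreover have "completed J \<rho> \<tau> \<inter> (Q - hit \<sigma> \<rho> r) = ?Z" by auto
    ultimately show ?thesis using E(3) by simp
  qed
  have avoid: "(real N - 1) * (val J (?X \<tau> \<union> ?Y \<tau>) - val J (?X \<tau>))
      \<le> (\<Sum>r<N. val J (?X \<tau> \<union> (?Y \<tau> - hit \<sigma> \<rho> r)) - val J (?X \<tau>))" for \<tau>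
  proof -
    \<comment> \<open>Fixing the completed set turns the marginal gain of \<open>?Y \<tau>\<close>
      into a difference \<open>?F (?Y \<tau>) - ?F {}\<close> for a monotone submodular
      \<open>?F\<close>.\<close>
    let ?F = "\<lambda>Z. val J (?X \<tau> \<union> Z)"
    have "submodular_on (item_set J) ?F"
      unfolding submodular_on_def
    proof (intro allI impI)
      fix Z W assume "Z \<subseteq> item_set J" "W \<subseteq> item_set J"
      moreover have "?X \<tau> \<union> (Z \<union> W) = (?X \<tau> \<union> Z) \<union> (?X \<tau> \<union> W)"
        "?X \<tau> \<union> (Z \<inter> W) = (?X \<tau> \<union> Z) \<inter> (?X \<tau> \<union> W)" by auto
      ultimately show "?F (Z \<union> W) + ?F (Z \<inter> W) \<le> ?F Z + ?F W"
        using val_submodular completed_subset[of \<sigma> \<tau>] unfolding submodular_on_def by simp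
    qed
    moreover have "mono_on (Pow (item_set J)) ?F"
      using completed_subset[of \<sigma> \<tau>] by (intro mono_onI val_mono) auto
    ultimately have "(real N - 1) * ?F (?Y \<tau>) + ?F {} \<le> (\<Sum>r<N. ?F (?Y \<tau> - hit \<sigma> \<rho> r))"
      using completed_subset[of \<rho> \<tau>] by (intro sum_avoid_hits) auto
    then show ?thesis by (simp add: sum_subtractf algebra_simps)
  qed
  have "(\<Sum>\<tau>\<le>?T. ?p \<tau> * ((real N - 1) * (val J (?X \<tau> \<union> ?Y \<tau>) - val J (?X \<tau>)))) -
      (\<Sum>r<N. \<Sum>\<tau>\<le>?T. ?p \<tau> * hit_marginal \<sigma> r \<tau>)
    \<le> (\<Sum>\<tau>\<le>?T. ?p \<tau> * (\<Sum>r<N. val J (?X \<tau> \<union> (?Y \<tau> - hit \<sigma> \<rho> r)) - val J (?X \<tau>))) -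
      (\<Sum>r<N. \<Sum>\<tau>\<le>?T. ?p \<tau> * hit_marginal \<sigma> r \<tau>)"
    using avoid by (intro diff_right_mono sum_mono mult_left_mono) auto
  also have "\<dots> = (\<Sum>r<N. \<Sum>\<tau>\<le>?T. ?p \<tau> *
      (val J (?X \<tau> \<union> (?Y \<tau> - hit \<sigma> \<rho> r)) - val J (?X \<tau>) - hit_marginal \<sigma> r \<tau>))"
    unfolding sum_distrib_left
    by (subst sum.swap) (simp add: sum_subtractf right_diff_distrib)
  also have "\<dots> \<le> (\<Sum>r<N. residual \<rho> (advance J \<sigma> r) (Q - hit \<sigma> \<rho> r))"
    unfolding residual_def by (intro sum_mono mult_left_mono step) auto
  finally show ?thesis
    by (simp add: sum_hit_marginal sum_weight_picks[OF N] residual_def sum_distrib_left mult.left_commute)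
qed

end

section \<open>Comparison with an optimal sequence over all rounds\<close>

context valid_knapsack
begin

lemma prefix_plan_nth:
  assumes "xs \<in> solutions J" "k < length xs"
  shows "prefix_plan J xs (xs ! k) = sum_list (map (size_of J) (take k xs))"
proof -
  have "distinct xs" using assms by (simp add: solutions_def permutations_of_set_def)
  then have "takeWhile (\<lambda>j. j \<noteq> xs ! k) xs = take k xs"
    using assms(2) by (intro takeWhile_eq_take_P_nth) (auto simp: nth_eq_iff_index_eq)
  then show ?thesis by (simp add: prefix_plan_def)
qed

lemma total_size_solution:
  assumes "xs \<in> solutions J"
  shows "sum_list (map (size_of J) xs) = total_size J"
  using assms by (auto simp: solutions_def permutations_of_set_def total_size_def
      sum_list_distinct_conv_sum_set)

lemma prefix_plan_bound:
  assumes xs: "xs \<in> solutions J" and i: "i \<in> item_set J"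
  shows "prefix_plan J xs i + size_of J i \<le> total_size J"
proof -
  obtain k where k: "k < length xs" "i = xs ! k"
    using xs i unfolding solutions_def permutations_of_set_def in_set_conv_nth[symmetric]
    by (metis (mono_tags, lifting) in_set_conv_nth mem_Collect_eq)
  have "prefix_plan J xs i + size_of J i = sum_list (map (size_of J) (take (Suc k) xs))"
    using prefix_plan_nth[OF xs k(1)] k by (simp add: take_Suc_conv_app_nth)
  also have "\<dots> \<le> sum_list (map (size_of J) (take (Suc k) xs @ drop (Suc k) xs))"
    unfolding map_append sum_list_append by simp
  finally show ?thesis by (simp add: total_size_solution[OF xs])
qed

text \<open>A sequence competes in the dynamic program: its prefix of length \<open>k\<close> is a
  packing that layer \<open>k\<close> can hold, and \<open>best_extend\<close> appends the items one
  by one.\<close>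

lemma gains_le_best:
  assumes xs: "xs \<in> solutions J" and Q: "Q \<subseteq> item_set J"
    and w: "\<And>i c. i \<in> item_set J \<Longrightarrow> 0 \<le> w i c"
  shows "(\<Sum>i\<in>Q. w i (prefix_plan J xs i + size_of J i)) \<le> fst (best J w (items J) (total_size J))"
proof -
  have set: "set xs = item_set J" "distinct xs"
    using xs by (auto simp: solutions_def permutations_of_set_def)
  have len: "length xs = items J"
    using set by (metis card_lessThan distinct_card item_set_def)
  let ?v = "\<lambda>i. w i (prefix_plan J xs i + size_of J i)"
  have "(\<Sum>i\<in>set (take k xs). ?v i)
      \<le> fst (best J w k (sum_list (map (size_of J) (take k xs))))" if "k \<le> length xs" for k
    using that
  proof (induction k)
    case (Suc k)
    let ?i = "xs ! k" and ?t = "sum_list (map (size_of J) (take k xs))"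
    have tk: "take (Suc k) xs = take k xs @ [?i]"
      using Suc.prems by (simp add: take_Suc_conv_app_nth)
    have "distinct (take (Suc k) xs)" using set(2) by simp
    then have "?i \<notin> set (take k xs)" unfolding tk by simp
    then have "(\<Sum>i\<in>set (take (Suc k) xs). ?v i) = ?v ?i + (\<Sum>i\<in>set (take k xs). ?v i)"
      unfolding tk by simp
    also have "\<dots> \<le> fst (best J w k ?t) + w ?i (?t + size_of J ?i)"
      using Suc prefix_plan_nth[OF xs, of k] by simp
    also have "\<dots> \<le> fst (best J w (Suc k) (?t + size_of J ?i))"
      using best_extend[of ?i J "?t + size_of J ?i" w k] size_pos[of ?i] Suc.prems set(1)
      by (metis Suc_le_lessD diff_add_inverse2 le_add2 nth_mem)
    finally show ?case unfolding tk by simp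
  qed simp
  from this[of "length xs"] have "(\<Sum>i\<in>item_set J. ?v i) \<le> fst (best J w (items J) (total_size J))"
    by (simp add: set len total_size_solution[OF xs])
  \<comment> \<open>The whole sequence was packed; items outside \<open>Q\<close> only add
    nonnegative weight.\<close>
  moreover have "(\<Sum>i\<in>Q. ?v i) \<le> (\<Sum>i\<in>item_set J. ?v i)"
    using Q w by (intro sum_mono2) auto
  ultimately show ?thesis by simp
qed

text \<open>This is \<open>W \<ge> \<Psi>\<close>. Submodularity bounds \<Psi> by single-item
  marginals; after exchanging the sums, each item collects its marginals from its end time on, which
  is its gain because its start is uncovered.\<close>

lemma residual_le_best:
  assumes xs: "xs \<in> solutions J" and Q: "Q \<subseteq> item_set J"
    and free: "\<And>i. i \<in> Q \<Longrightarrow> \<not> covered J \<sigma> (prefix_plan J xs i)"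
  shows "residual (prefix_plan J xs) \<sigma> Q \<le> fst (best J (gain J \<sigma>) (items J) (total_size J))"
proof -
  let ?\<rho> = "prefix_plan J xs" and ?T = "total_size J" and ?p = "pmf (cap J)"
  have fin: "finite Q" using Q by (rule finite_subset) simp
  have "residual ?\<rho> \<sigma> Q
      \<le> (\<Sum>\<tau>\<le>?T. ?p \<tau> * (\<Sum>i\<in>completed J ?\<rho> \<tau> \<inter> Q. marginal J \<sigma> i \<tau>))"
    unfolding residual_def marginal_def using Q fin
    by (intro sum_mono mult_left_mono submodular_sum_marginals[OF val_submodular val_mono_on]
        completed_subset) auto
  also have "\<dots> = (\<Sum>\<tau>\<le>?T. \<Sum>i\<in>Q. if ?\<rho> i + size_of J i \<le> \<tau> then ?p \<tau> * marginal J \<sigma> i \<tau> else 0)"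
    unfolding sum_distrib_left using fin Q
    by (intro sum.cong refl sum.mono_neutral_cong_left) (auto simp: completed_def)
  also have "\<dots> = (\<Sum>i\<in>Q. \<Sum>\<tau>\<le>?T. if ?\<rho> i + size_of J i \<le> \<tau> then ?p \<tau> * marginal J \<sigma> i \<tau> else 0)"
    by (rule sum.swap)
  also have "\<dots> = (\<Sum>i\<in>Q. gain J \<sigma> i (?\<rho> i + size_of J i))"
  proof (rule sum.cong)
    fix i assume i: "i \<in> Q"
    have "gain J \<sigma> i (?\<rho> i + size_of J i) =
        (\<Sum>\<tau>=?\<rho> i + size_of J i..?T. ?p \<tau> * marginal J \<sigma> i \<tau>)"
      using free[OF i] by (simp add: gain_def)
    also have "\<dots> = (\<Sum>\<tau>\<le>?T. if ?\<rho> i + size_of J i \<le> \<tau> then ?p \<tau> * marginal J \<sigma> i \<tau> else 0)"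
      by (intro sum.mono_neutral_cong_left) auto
    finally show "(\<Sum>\<tau>\<le>?T. if ?\<rho> i + size_of J i \<le> \<tau> then ?p \<tau> * marginal J \<sigma> i \<tau> else 0) =
        gain J \<sigma> i (?\<rho> i + size_of J i)" by simp
  qed simp
  also have "\<dots> \<le> fst (best J (gain J \<sigma>) (items J) ?T)"
    using gains_le_best[OF xs Q] gain_nonneg by blast
  finally show ?thesis .
qed

lemma advance_cases:
  obtains "advance J \<sigma> r = \<sigma>"
  | i c where "picks J \<sigma> r = Some (i, c)" "0 < gain J \<sigma> i c" "advance J \<sigma> r = reschedule J \<sigma> i c"
proof (cases "advance J \<sigma> r = \<sigma>")
  case False
  then obtain i c where "picks J \<sigma> r = Some (i, c)" "0 < gain J \<sigma> i c"
    by (auto simp: advance_def split: option.splits if_splits)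
  then show thesis by (intro that(2)) (auto simp: advance_def)
qed

text \<open>Preserves the condition on \<open>Q\<close>. The only interval added below
  \<open>total_size J\<close> misses the starts that are not hit, and evicted items cover only
  points from \<open>total_size J\<close> on.\<close>

lemma not_covered_advance:
  assumes "\<not> covered J \<sigma> (\<rho> i)" "i \<in> item_set J" "i \<notin> hit \<sigma> \<rho> r" "\<rho> i < total_size J"
  shows "\<not> covered J (advance J \<sigma> r) (\<rho> i)"
proof (cases rule: advance_cases[of \<sigma> r])
  case (2 i' c)
  have "i \<notin> {j \<in> item_set J. c - size_of J i' \<le> \<rho> j \<and> \<rho> j < c}"
    using assms(3) 2 by (simp add: hit_def)
  then have "\<rho> i < c - size_of J i' \<or> c \<le> \<rho> i" using assms(2) by auto
  then have "\<not> (reschedule J \<sigma> i' c j \<le> \<rho> i \<and> \<rho> i < reschedule J \<sigma> i' c j + size_of J j)"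
    if "j \<in> item_set J" for j
    using assms(1,4) picksD(3)[OF 2(1)] that
    by (auto simp: covered_def reschedule_def)
  then show ?thesis unfolding covered_def 2(3) by blast
qed (use assms in simp)

text \<open>Intervals that start inside the new one are evicted, and those that start before it end
  in time because its own start is uncovered.\<close>

lemma feasible_advance:
  assumes f: "feasible J \<sigma>"
  shows "feasible J (advance J \<sigma> r)"
proof (cases rule: advance_cases[of \<sigma> r])
  case (2 i c)
  note i = picksD[OF 2(1)] and g = gain_pos[OF 2(2) picksD(2)[OF 2(1)]]
  have "reschedule J \<sigma> i c j \<le> total_size J" if "j \<in> item_set J" for j
    using f that i by (auto simp: feasible_def reschedule_def)
  moreover have "reschedule J \<sigma> i c j + size_of J j \<le> reschedule J \<sigma> i c k"
    if jk: "j \<in> item_set J" "k \<in> item_set J" "j \<noteq> k"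
      "reschedule J \<sigma> i c j \<le> reschedule J \<sigma> i c k" "reschedule J \<sigma> i c k < total_size J" for j k
  proof -
    have sep: "\<sigma> j + size_of J j \<le> \<sigma> k" if "\<sigma> j \<le> \<sigma> k" "\<sigma> k < total_size J"
      using f jk that by (auto simp: feasible_def)
    consider "j = i" | "k = i" | "j \<noteq> i" "k \<noteq> i" by blast
    then show ?thesis
    proof cases
      case 1
      then show ?thesis using jk i by (auto simp: reschedule_def split: if_splits)
    next
      case 2
      then have "\<sigma> j \<le> c - size_of J i"
        using jk i by (auto simp: reschedule_def split: if_splits)
      then have "\<sigma> j + size_of J j \<le> c - size_of J i"
        using g(2) jk(1) by (auto simp: covered_def not_less)
      then show ?thesis
        using jk 2 i size_pos[of i] size_pos[of j]
        by (auto simp: reschedule_def split: if_splits)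
    next
      case 3
      then show ?thesis using jk sep by (auto simp: reschedule_def split: if_splits)
    qed
  qed
  ultimately show ?thesis unfolding 2(3) feasible_def by blast
qed (use assms in simp)

lemma chain_support:
  assumes "0 < N"
  shows "finite (set_pmf (chain J N k \<sigma>)) \<and>
    (feasible J \<sigma> \<longrightarrow> (\<forall>\<sigma>'\<in>set_pmf (chain J N k \<sigma>). feasible J \<sigma>'))"
proof (induction k arbitrary: \<sigma>)
  case (Suc k)
  have "set_pmf (pmf_of_set {..<N}) = {..<N}" using assms by (intro set_pmf_of_set) auto
  then show ?case using Suc feasible_advance by auto
qed simp

lemma expectation_chain_Suc:
  assumes "0 < N"
  shows "measure_pmf.expectation (chain J N (Suc k) \<sigma>) h =
    (\<Sum>r<N. measure_pmf.expectation (chain J N k (advance J \<sigma> r)) h) / real N"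
proof -
  have "measure_pmf.expectation (chain J N (Suc k) \<sigma>) h =
      (\<Sum>r<N. measure_pmf.expectation (chain J N k (advance J \<sigma> r)) h /\<^sub>R real (card {..<N}))"
    unfolding chain.simps using assms chain_support[OF assms]
    by (intro pmf_expectation_bind_pmf_of_set) auto
  then show ?thesis by (simp add: divide_inverse_commute sum_distrib_left)
qed

text \<open>In the extreme case \<open>W = \<Psi>\<close> a round is the linear map from
  \<open>(g, \<Psi>)\<close> to \<open>(u g + (1 - u) \<Psi>, (2 u - 1) \<Psi>)\<close>; the
  coefficients form the first row of its \<open>k\<close>-th power. The induction splits off the
  first round, hence the arbitrary \<open>\<sigma>\<close> and \<open>Q\<close>.\<close>

lemma chain_plan_value:
  fixes u :: real
  assumes xs: "xs \<in> solutions J" and N: "items J \<le> N" "2 \<le> N" and u: "u = 1 - 1 / real N"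
    and Q: "Q \<subseteq> item_set J" "\<And>i. i \<in> Q \<Longrightarrow> \<not> covered J \<sigma> (prefix_plan J xs i)"
  shows "u ^ k * plan_value J \<sigma> + (u ^ k - (2 * u - 1) ^ k) * residual (prefix_plan J xs) \<sigma> Q
    \<le> measure_pmf.expectation (chain J N k \<sigma>) (plan_value J)"
  using Q
proof (induction k arbitrary: \<sigma> Q)
  case (Suc k)
  let ?\<rho> = "prefix_plan J xs" and ?W = "fst (best J (gain J \<sigma>) (items J) (total_size J))"
  let ?a = "u ^ k" and ?c = "(2 * u - 1) ^ k" and ?n = "real N"
  let ?Q = "\<lambda>r. Q - hit \<sigma> ?\<rho> r"
  have u01: "0 \<le> 2 * u - 1" "2 * u - 1 \<le> u" and n: "?n \<ge> 2" using N by (auto simp: u field_simps)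
  have c: "0 \<le> ?c" "?c \<le> ?a" using u01 by (auto intro: power_mono)
  have "?a * ((?n - 1) * plan_value J \<sigma> + ?W) + (?a - ?c) * ((?n - 1) * residual ?\<rho> \<sigma> Q - ?W)
      \<le> ?a * (\<Sum>r<N. plan_value J (advance J \<sigma> r)) +
        (?a - ?c) * (\<Sum>r<N. residual ?\<rho> (advance J \<sigma> r) (?Q r))"
    using c by (intro add_mono mult_left_mono sum_plan_value_advance sum_residual_advance N) auto
  also have "\<dots> = (\<Sum>r<N. ?a * plan_value J (advance J \<sigma> r) +
      (?a - ?c) * residual ?\<rho> (advance J \<sigma> r) (?Q r))"
    by (simp add: sum.distrib sum_distrib_left)
  also have "\<dots> \<le> (\<Sum>r<N. measure_pmf.expectation (chain J N k (advance J \<sigma> r)) (plan_value J))"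
  proof (intro sum_mono Suc.IH)
    fix r i assume "i \<in> ?Q r"
    then show "\<not> covered J (advance J \<sigma> r) (?\<rho> i)"
      using Suc.prems prefix_plan_bound[OF xs, of i] size_pos[of i]
      by (intro not_covered_advance) auto
  qed (use Suc.prems in auto)
  also have "\<dots> = ?n * measure_pmf.expectation (chain J N (Suc k) \<sigma>) (plan_value J)"
    using N by (subst expectation_chain_Suc) auto
  finally have "?a * (?n - 1) * plan_value J \<sigma> + (?a - ?c) * (?n - 1) * residual ?\<rho> \<sigma> Q + ?c * ?W
      \<le> ?n * measure_pmf.expectation (chain J N (Suc k) \<sigma>) (plan_value J)"
    by (simp add: algebra_simps)
  \<comment> \<open>\<open>W\<close> is left with the coefficient
    \<open>?a - (?a - ?c) = ?c\<close>, nonnegative thanks to \<open>2 \<le> N\<close>, so it may be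
    replaced by its lower bound \<Psi>.\<close>
  moreover have "?c * residual ?\<rho> \<sigma> Q \<le> ?c * ?W"
    using c residual_le_best[OF xs Suc.prems] by (intro mult_left_mono) auto
  ultimately have main: "?a * (?n - 1) * plan_value J \<sigma> +
      ((?a - ?c) * (?n - 1) + ?c) * residual ?\<rho> \<sigma> Q
      \<le> ?n * measure_pmf.expectation (chain J N (Suc k) \<sigma>) (plan_value J)"
    by (simp add: algebra_simps)
  have eqs: "?a * (?n - 1) = ?n * u ^ Suc k"
    "(?a - ?c) * (?n - 1) + ?c = ?n * (u ^ Suc k - (2 * u - 1) ^ Suc k)"
    using n by (auto simp: u field_simps)
  have "?n * (u ^ Suc k * plan_value J \<sigma> +
      (u ^ Suc k - (2 * u - 1) ^ Suc k) * residual ?\<rho> \<sigma> Q)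
      \<le> ?n * measure_pmf.expectation (chain J N (Suc k) \<sigma>) (plan_value J)"
    using main unfolding eqs by (simp only: distrib_left mult.assoc)
  then show ?case using n by simp
qed simp

end

section \<open>The number of rounds and the final ratio\<close>

definition initial_plan :: "knapsack \<Rightarrow> nat \<Rightarrow> nat" where
  "initial_plan J i = (if i \<in> item_set J then total_size J else 0)"

definition rounds :: "nat \<Rightarrow> nat" where
  "rounds N = (LEAST k. (1 - 1 / real N) ^ k \<le> 1 / 2)"

text \<open>From \<open>1 - x \<le> exp (- x)\<close> and \<open>2 \<le> exp 1\<close>. It shows
  that the minimum in \<open>rounds\<close> exists and is at most \<open>N\<close>.\<close>

lemma rounds_bound:
  assumes "0 < N"
  shows "(1 - 1 / real N) ^ N \<le> 1 / 2"
proof -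
  have "(1 - 1 / real N) ^ N \<le> exp (- 1 / real N) ^ N"
    using assms exp_ge_add_one_self[of "- 1 / real N"] by (intro power_mono) auto
  also have "\<dots> = exp (real N * (- 1 / real N))" by (simp only: exp_of_nat_mult)
  also have "\<dots> = inverse (exp 1)" using assms by (simp add: exp_minus)
  also have "\<dots> \<le> inverse 2"
    using exp_ge_add_one_self[of 1] by (intro le_imp_inverse_le) auto
  finally show ?thesis by simp
qed

lemma rounds:
  assumes "0 < N"
  shows "rounds N \<le> N" "(1 - 1 / real N) ^ rounds N \<le> 1 / 2"
    "k < rounds N \<Longrightarrow> 1 / 2 < (1 - 1 / real N) ^ k"
proof -
  let ?P = "\<lambda>k. (1 - 1 / real N) ^ k \<le> 1 / 2"
  have P: "?P N" using assms by (rule rounds_bound)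
  show "rounds N \<le> N" unfolding rounds_def using P by (rule Least_le)
  show "?P (rounds N)" unfolding rounds_def using P by (rule LeastI)
  show "1 / 2 < (1 - 1 / real N) ^ k" if "k < rounds N"
    using not_less_Least[of k ?P] that unfolding rounds_def by linarith
qed

text \<open>With \<open>x = u ^ Suc K\<close>, bounding the second power by \<open>x * x\<close>
  would give \<open>x - x * x\<close>, which falls short of 1/4 for \<open>x < 1 / 2\<close>. So
  \<open>2 * u - 1 \<le> u\<^sup>2\<close> is applied to only \<open>K\<close> of the
  \<open>Suc K\<close> factors.\<close>

lemma quarter_bound:
  fixes u :: real
  assumes u: "0 \<le> 2 * u - 1" "u \<le> 1" and K: "u ^ Suc K \<le> 1 / 2" "1 / 2 < u ^ K"
  shows "1 / 4 \<le> u ^ Suc K - (2 * u - 1) ^ Suc K"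
proof -
  let ?b = "u ^ K"
  have "2 * u - 1 \<le> u\<^sup>2" using zero_le_power2[of "u - 1"] by (simp add: power2_eq_square algebra_simps)
  then have "(2 * u - 1) ^ K \<le> (u\<^sup>2) ^ K" using u by (intro power_mono) auto
  also have "\<dots> = ?b * ?b" by (simp add: power_mult_distrib power2_eq_square)
  finally have "(2 * u - 1) ^ Suc K \<le> (2 * u - 1) * (?b * ?b)"
    using u by (simp add: mult_left_mono)
  moreover have "(2 * u - 1) * ?b \<le> u * ?b" using u K by (intro mult_right_mono) auto
  then have "(2 * u - 1) * ?b \<le> 1 / 2" using K(1) unfolding power_Suc by (rule order_trans)
  \<comment> \<open>Expanded, this product is exactly
    \<open>u * ?b - (2 * u - 1) * (?b * ?b) - 1 / 4\<close>.\<close>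
  then have "0 \<le> (?b - 1 / 2) * (1 / 2 - (2 * u - 1) * ?b)" using K by (intro mult_nonneg_nonneg) auto
  ultimately show ?thesis by (simp add: algebra_simps)
qed

context valid_knapsack
begin

lemma feasible_initial: "feasible J (initial_plan J)"
  by (auto simp: feasible_def initial_plan_def)

text \<open>Initially nothing is scheduled and no start of the optimal sequence is covered, so the
  value is 0 and \<Psi>, taken over all items, is the whole optimum.\<close>

lemma chain_objective:
  assumes N: "items J \<le> N" "2 \<le> N"
  shows "opt J / 4 \<le> measure_pmf.expectation (chain J N (rounds N) (initial_plan J))
    (\<lambda>\<sigma>. objective J (bucket_sort J \<sigma>))"
proof -
  let ?u = "1 - 1 / real N" and ?M = "chain J N (rounds N) (initial_plan J)"
  have "opt J \<in> objective J ` solutions J"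
    unfolding opt_def using finite_solutions solutions_nonempty by (intro Max_in) auto
  then obtain xs where xs: "xs \<in> solutions J" "objective J xs = opt J" by force
  have empty: "completed J (initial_plan J) \<tau> = {}" if "\<tau> \<le> total_size J" for \<tau>
    using that size_pos by (fastforce simp: completed_def initial_plan_def)
  have Q: "\<not> covered J (initial_plan J) (prefix_plan J xs i)" if "i \<in> item_set J" for i
    using prefix_plan_bound[OF xs(1) that] size_pos[OF that]
    by (auto simp: covered_def initial_plan_def)
  have v: "plan_value J (initial_plan J) = 0"
    by (simp add: plan_value_def empty val_empty)
  have "residual (prefix_plan J xs) (initial_plan J) (item_set J) = plan_value J (prefix_plan J xs)"
    using completed_subset
    by (simp add: residual_def plan_value_def empty val_empty Int_absorb2)
  then have r: "residual (prefix_plan J xs) (initial_plan J) (item_set J) = opt J"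
    using objective_prefix_plan[OF xs(1)] xs(2) by simp
  have opt0: "0 \<le> opt J"
    unfolding xs(2)[symmetric] objective_prefix_plan[OF xs(1)] plan_value_def
    by (intro sum_nonneg mult_nonneg_nonneg val_nonneg completed_subset) auto
  have "rounds N \<noteq> 0" using rounds(2)[of N] N by (cases "rounds N") auto
  then obtain K where K: "rounds N = Suc K" using not0_implies_Suc by blast
  have "1 / 4 \<le> ?u ^ rounds N - (2 * ?u - 1) ^ rounds N"
    unfolding K using rounds(2,3)[of N] N K
    by (intro quarter_bound) (auto simp: field_simps)
  then have "opt J / 4 \<le> (?u ^ rounds N - (2 * ?u - 1) ^ rounds N) * opt J"
    using mult_right_mono[OF _ opt0, of "1 / 4"] by simp
  also have "\<dots> \<le> measure_pmf.expectation ?M (plan_value J)"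
    using chain_plan_value[OF xs(1) N refl subset_refl Q, of "rounds N"] by (simp add: v r)
  also have "\<dots> \<le> measure_pmf.expectation ?M (\<lambda>\<sigma>. objective J (bucket_sort J \<sigma>))"
    using chain_support[of N "rounds N" "initial_plan J"] feasible_initial N
    by (intro integral_mono_AE integrable_measure_pmf_finite)
      (auto simp: AE_measure_pmf_iff plan_value_le_objective)
  finally show ?thesis .
qed

end

section \<open>Program logic\<close>

definition halting :: "knapsack \<Rightarrow> nat \<Rightarrow> config \<Rightarrow> bool" where
  "halting J l cfg \<longleftrightarrow> (\<forall>cfg'\<in>set_pmf (steps J l cfg). fst cfg' = [])"

lemma steps_halting:
  assumes "halting J l cfg"
  shows "steps J (l + d) cfg = steps J l cfg"
proof -
  have "steps J (l + d) cfg = bind_pmf (steps J l cfg) (steps J d)" by (rule steps_add)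
  also have "\<dots> = bind_pmf (steps J l cfg) return_pmf"
    using assms by (intro bind_pmf_cong refl) (metis halting_def steps_final prod.collapse)
  finally show ?thesis by (simp add: bind_return_pmf')
qed

text \<open>\<open>k\<close> only bounds the number of steps, which may depend on the outcome; comparing exact
  step counts is avoided by looking at computations whose continuation has already halted.\<close>

definition runs :: "knapsack \<Rightarrow> com \<Rightarrow> memory \<Rightarrow> memory pmf \<Rightarrow> nat \<Rightarrow> bool" where
  "runs J c m M k \<longleftrightarrow>
     (\<forall>K l. (\<forall>m'\<in>set_pmf M. halting J l (K, m')) \<longrightarrow>
        steps J (k + l) (c # K, m) = bind_pmf M (\<lambda>m'. steps J l (K, m')))"

text \<open>Surplus steps are passed to the continuation, which has halted and absorbs them.\<close>

lemma runs_weaken: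
  assumes "runs J c m M k" "k \<le> k'"
  shows "runs J c m M k'"
  unfolding runs_def
proof (intro allI impI)
  fix K l assume h: "\<forall>m'\<in>set_pmf M. halting J l (K, m')"
  have "steps J (l + (k' - k)) (K, m') = steps J l (K, m')" if "m' \<in> set_pmf M" for m'
    using h that steps_halting by blast
  then have h': "\<forall>m'\<in>set_pmf M. halting J (l + (k' - k)) (K, m')"
    and eq: "bind_pmf M (\<lambda>m'. steps J (l + (k' - k)) (K, m')) = bind_pmf M (\<lambda>m'. steps J l (K, m'))"
    using h by (auto simp: halting_def intro!: bind_pmf_cong)
  have "steps J (k' + l) (c # K, m) = steps J (k + (l + (k' - k))) (c # K, m)"
    using assms(2) by (simp add: algebra_simps)
  also have "\<dots> = bind_pmf M (\<lambda>m'. steps J l (K, m'))"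
    using assms(1) h' unfolding eq[symmetric] runs_def by blast
  finally show "steps J (k' + l) (c # K, m) = bind_pmf M (\<lambda>m'. steps J l (K, m'))" .
qed

lemma runs_atomic:
  assumes "\<And>K. exec1 J c K m = map_pmf (Pair K) M"
  shows "runs J c m M 1"
  unfolding runs_def using assms by (simp add: bind_map_pmf)

lemma runs_Toss:
  "runs J (Toss a b) m
     (map_pmf (\<lambda>z. nstore (neval J a m) (neval J b m) (of_bool z) m) (bernoulli_pmf (1 / 2))) 1"
  by (rule runs_atomic) (simp add: pmf.map_comp o_def)

lemma runs_Seq:
  assumes c: "runs J c m M k" and d: "\<And>m'. m' \<in> set_pmf M \<Longrightarrow> runs J d m' (N m') l"
  shows "runs J (Seq c d) m (bind_pmf M N) (Suc (k + l))"
  unfolding runs_def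
proof (intro allI impI)
  fix K l' assume h: "\<forall>m'\<in>set_pmf (bind_pmf M N). halting J l' (K, m')"
  have d': "steps J (l + l') (d # K, m') = bind_pmf (N m') (\<lambda>m''. steps J l' (K, m''))"
    if "m' \<in> set_pmf M" for m'
    using d[OF that] h that unfolding runs_def by auto
  then have "halting J (l + l') (d # K, m')" if "m' \<in> set_pmf M" for m'
    using h that by (auto simp: halting_def)
  then have "steps J (k + (l + l')) (c # d # K, m) = bind_pmf M (\<lambda>m'. steps J (l + l') (d # K, m'))"
    using c unfolding runs_def by blast
  also have "\<dots> = bind_pmf (bind_pmf M N) (\<lambda>m''. steps J l' (K, m''))"
    unfolding bind_assoc_pmf using d' by (intro bind_pmf_cong) auto
  finally show "steps J (Suc (k + l) + l') (Seq c d # K, m) =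
      bind_pmf (bind_pmf M N) (\<lambda>m''. steps J l' (K, m''))"
    by (simp add: bind_return_pmf add.assoc)
qed

lemma runs_Cond:
  assumes "runs J (if beval J b m then c else d) m M k"
  shows "runs J (Cond b c d) m M (Suc k)"
  using assms unfolding runs_def by (simp add: bind_return_pmf)

lemma runs_Loop_False:
  assumes "\<not> beval J b m"
  shows "runs J (Loop b c) m (return_pmf m) 1"
  using assms unfolding runs_def by (simp add: bind_return_pmf)

lemma runs_Loop_True:
  assumes "beval J b m" "runs J c m M k"
    "\<And>m'. m' \<in> set_pmf M \<Longrightarrow> runs J (Loop b c) m' (N m') l"
  shows "runs J (Loop b c) m (bind_pmf M N) (Suc (k + l))"
proof -
  \<comment> \<open>A loop with a true guard unfolds in one step to the same configuration as the
    sequence of its body and itself.\<close>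
  have "steps J (Suc n) (Loop b c # K, m) = steps J (Suc n) (Seq c (Loop b c) # K, m)" for n K
    using assms(1) by (simp add: bind_return_pmf)
  then show ?thesis using runs_Seq[OF assms(2,3)] unfolding runs_def by auto
qed

text \<open>\<open>output_pmf\<close> refers to the least halting time, whereas \<open>k\<close> is
  only a bound; \<open>run_stable\<close> identifies the two distributions.\<close>

lemma runs_run:
  assumes "runs J P \<lparr>nmem = \<lambda>_ _. 0, rmem = \<lambda>_ _. 0\<rparr> M k"
  shows "halts P J" "running_time P J \<le> k"
    "output_pmf P J = map_pmf (\<lambda>m. map (nmem m 0) [0..<items J]) M"
proof -
  have "run J P k = bind_pmf M (\<lambda>m'. steps J 0 ([], m'))"
    using assms[unfolded runs_def, rule_format, of 0 "[]"]
    by (simp add: run_def halting_def)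
  then have r: "run J P k = map_pmf (Pair []) M" by (simp add: map_pmf_def)
  then have h: "halts_within P J k" by (auto simp: halts_within_def)
  then show "halts P J" by (auto simp: halts_def)
  show le: "running_time P J \<le> k" unfolding running_time_def using h by (rule Least_le)
  have "halts_within P J (running_time P J)"
    unfolding running_time_def using h by (rule LeastI)
  then have "run J P (running_time P J) = map_pmf (Pair []) M"
    using run_stable le r by metis
  then show "output_pmf P J = map_pmf (\<lambda>m. map (nmem m 0) [0..<items J]) M"
    by (simp add: output_pmf_def pmf.map_comp o_def)
qed

lemma nmem_nstore [simp]: "nmem (nstore a b v m) x = (if x = a then (nmem m a)(b := v) else nmem m x)"
  and rmem_nstore [simp]: "rmem (nstore a b v m) = rmem m"
  and nmem_rstore [simp]: "nmem (rstore a b w m) = nmem m"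
  and rmem_rstore [simp]: "rmem (rstore a b w m) x = (if x = a then (rmem m a)(b := w) else rmem m x)"
  by (simp_all add: nstore_def rstore_def)

section \<open>Deterministic code: symbolic execution and timed triples\<close>

primrec straight :: "com \<Rightarrow> bool" where
  "straight Skip \<longleftrightarrow> True"
| "straight (NStore a b e) \<longleftrightarrow> True"
| "straight (RStore a b e) \<longleftrightarrow> True"
| "straight (Toss a b) \<longleftrightarrow> False"
| "straight (Seq c d) \<longleftrightarrow> straight c \<and> straight d"
| "straight (Cond b c d) \<longleftrightarrow> straight c \<and> straight d"
| "straight (Loop b c) \<longleftrightarrow> False"

primrec effect :: "knapsack \<Rightarrow> com \<Rightarrow> memory \<Rightarrow> memory" where
  "effect J Skip m = m"
| "effect J (NStore a b e) m = nstore (neval J a m) (neval J b m) (neval J e m) m"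
| "effect J (RStore a b e) m = rstore (neval J a m) (neval J b m) (reval J e m) m"
| "effect J (Toss a b) m = m"
| "effect J (Seq c d) m = effect J d (effect J c m)"
| "effect J (Cond b c d) m = (if beval J b m then effect J c m else effect J d m)"
| "effect J (Loop b c) m = m"

text \<open>Both branches of a conditional are charged, which makes the bound independent of the
  memory.\<close>

primrec cost :: "com \<Rightarrow> nat" where
  "cost Skip = 1"
| "cost (NStore a b e) = 1"
| "cost (RStore a b e) = 1"
| "cost (Toss a b) = 1"
| "cost (Seq c d) = cost c + cost d + 1"
| "cost (Cond b c d) = cost c + cost d + 1"
| "cost (Loop b c) = 1"

lemma runs_straight: "straight c \<Longrightarrow> runs J c m (return_pmf (effect J c m)) (cost c)"
proof (induction c arbitrary: m)
  case (Seq c d)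
  then have "runs J (Seq c d) m (bind_pmf (return_pmf (effect J c m)) (\<lambda>m'. return_pmf (effect J d m')))
      (Suc (cost c + cost d))"
    by (intro runs_Seq) auto
  then show ?case by (simp add: bind_return_pmf)
next
  case (Cond b c d)
  have "runs J (if beval J b m then c else d) m (return_pmf (effect J (Cond b c d) m)) (cost c + cost d)"
  proof (cases "beval J b m")
    case True
    then show ?thesis using Cond runs_weaken[of J c m _ "cost c"] by simp
  next
    case False
    then show ?thesis using Cond runs_weaken[of J d m _ "cost d"] by simp
  qed
  from runs_Cond[OF this] show ?case by simp
qed (auto intro!: runs_atomic[simplified])

text \<open>Total correctness with a time bound for code whose outcome is a single memory. The
  random parts, \<open>draw\<close> and \<open>iterate\<close>, are treated directly with
  \<open>runs\<close>.\<close>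

definition hoare :: "knapsack \<Rightarrow> (memory \<Rightarrow> bool) \<Rightarrow> com \<Rightarrow> nat \<Rightarrow> (memory \<Rightarrow> bool) \<Rightarrow> bool" where
  "hoare J P c k Q \<longleftrightarrow> (\<forall>m. P m \<longrightarrow> (\<exists>m'. runs J c m (return_pmf m') k \<and> Q m'))"

lemma hoare_straight:
  assumes "straight c" "cost c \<le> k" "\<And>m. P m \<Longrightarrow> Q (effect J c m)"
  shows "hoare J P c k Q"
  using assms runs_straight runs_weaken unfolding hoare_def by blast

lemma hoare_conseq:
  assumes "hoare J P c k Q" "\<And>m. P' m \<Longrightarrow> P m" "\<And>m. Q m \<Longrightarrow> Q' m" "k \<le> k'"
  shows "hoare J P' c k' Q'"
  using assms runs_weaken unfolding hoare_def by blast

lemma hoare_Seq: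
  assumes "hoare J P c k R" "hoare J R d l Q" "Suc (k + l) \<le> k'"
  shows "hoare J P (Seq c d) k' Q"
  unfolding hoare_def
proof (intro allI impI)
  fix m assume "P m"
  then obtain m1 m2 where "runs J c m (return_pmf m1) k" "runs J d m1 (return_pmf m2) l" "Q m2"
    using assms(1,2) unfolding hoare_def by blast
  then have "runs J (Seq c d) m (bind_pmf (return_pmf m1) (\<lambda>_. return_pmf m2)) (Suc (k + l))"
    by (intro runs_Seq) auto
  then have "runs J (Seq c d) m (return_pmf m2) k'"
    unfolding bind_return_pmf using assms(3) by (rule runs_weaken)
  then show "\<exists>m'. runs J (Seq c d) m (return_pmf m') k' \<and> Q m'"
    using \<open>Q m2\<close> by blast
qed

lemma hoare_Cond:
  assumes "hoare J (\<lambda>m. P m \<and> beval J b m) c k Q" "hoare J (\<lambda>m. P m \<and> \<not> beval J b m) d k Q"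
    "Suc k \<le> k'"
  shows "hoare J P (Cond b c d) k' Q"
  unfolding hoare_def
proof (intro allI impI)
  fix m assume "P m"
  then obtain m' where "runs J (if beval J b m then c else d) m (return_pmf m') k" "Q m'"
    using assms(1,2) unfolding hoare_def by (cases "beval J b m") auto
  then show "\<exists>m'. runs J (Cond b c d) m (return_pmf m') k' \<and> Q m'"
    using runs_weaken[OF runs_Cond assms(3)] by blast
qed

abbreviation nvar :: "nat \<Rightarrow> nexp" where "nvar x \<equiv> NCell (Num x) (Num 0)"
abbreviation rvar :: "nat \<Rightarrow> rexp" where "rvar x \<equiv> RCell (Num x) (Num 0)"
abbreviation nassign :: "nat \<Rightarrow> nexp \<Rightarrow> com" where "nassign x \<equiv> NStore (Num x) (Num 0)"
abbreviation rassign :: "nat \<Rightarrow> rexp \<Rightarrow> com" where "rassign x \<equiv> RStore (Num x) (Num 0)"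

definition For :: "nat \<Rightarrow> nexp \<Rightarrow> com \<Rightarrow> com" where
  "For v e c =
     Seq (nassign v (Num 0)) (Loop (NLess (nvar v) e) (Seq c (nassign v (NAdd (nvar v) (Num 1)))))"

text \<open>The counter is kept out of the invariant (\<open>stable\<close>), which takes its value
  as a parameter instead. An iteration costs 3 steps besides the body: guard, sequencing and
  increment; initialization and the last guard cost another 3. The induction is on the number
  \<open>d\<close> of remaining iterations.\<close>

lemma hoare_For:
  assumes body: "\<And>i. i < n \<Longrightarrow>
      hoare J (\<lambda>m. I i m \<and> nmem m v 0 = i) c k (\<lambda>m. I (Suc i) m \<and> nmem m v 0 = i)"
    and stable: "\<And>i m x. I i m \<Longrightarrow> I i (nstore v 0 x m)"
    and bound: "\<And>i m. I i m \<Longrightarrow> neval J e m = n"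
    and init: "\<And>m. P m \<Longrightarrow> I 0 m" and final: "\<And>m. I n m \<Longrightarrow> Q m"
    and k': "n * (k + 3) + 3 \<le> k'"
  shows "hoare J P (For v e c) k' Q"
proof -
  let ?L = "Loop (NLess (nvar v) e) (Seq c (nassign v (NAdd (nvar v) (Num 1))))"
  have loop: "hoare J (\<lambda>m. I (n - d) m \<and> nmem m v 0 = n - d) ?L (d * (k + 3) + 1) (I n)"
    if "d \<le> n" for d
    using that
  proof (induction d)
    case 0
    have "runs J ?L m (return_pmf m) 1" if "I n m" "nmem m v 0 = n" for m
      using bound[OF that(1)] that(2) by (intro runs_Loop_False) simp
    then show ?case by (auto simp: hoare_def)
  next
    case (Suc d)
    let ?i = "n - Suc d" and ?c = "Seq c (nassign v (NAdd (nvar v) (Num 1)))"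
    have i: "?i < n" "Suc ?i = n - d" using Suc.prems by auto
    have c: "hoare J (\<lambda>m. I ?i m \<and> nmem m v 0 = ?i) ?c (k + 2)
        (\<lambda>m. I (n - d) m \<and> nmem m v 0 = n - d)"
    proof (rule hoare_Seq[OF body[OF i(1), unfolded i(2)] hoare_straight[where k = 1]])
      fix m assume "I (n - d) m \<and> nmem m v 0 = ?i"
      then show "I (n - d) (effect J (nassign v (NAdd (nvar v) (Num 1))) m) \<and>
          nmem (effect J (nassign v (NAdd (nvar v) (Num 1))) m) v 0 = n - d"
        using stable i(2) by simp
    qed auto
    show ?case unfolding hoare_def
    proof (intro allI impI, elim conjE)
      fix m assume m: "I ?i m" "nmem m v 0 = ?i"
      then obtain m1 where m1: "runs J ?c m (return_pmf m1) (k + 2)" "I (n - d) m1"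
          "nmem m1 v 0 = n - d"
        using c unfolding hoare_def by blast
      then obtain m2 where m2: "runs J ?L m1 (return_pmf m2) (d * (k + 3) + 1)" "I n m2"
        using Suc unfolding hoare_def by auto
      have "runs J ?L m (bind_pmf (return_pmf m1) (\<lambda>_. return_pmf m2))
          (Suc (k + 2 + (d * (k + 3) + 1)))"
        using bound[OF m(1)] m(2) i m1 m2 by (intro runs_Loop_True) auto
      moreover have "Suc (k + 2 + (d * (k + 3) + 1)) = Suc d * (k + 3) + 1" by simp
      ultimately show "\<exists>m'. runs J ?L m (return_pmf m') (Suc d * (k + 3) + 1) \<and> I n m'"
        using m2(2) unfolding bind_return_pmf by metis
    qed
  qed
  have "hoare J P (For v e c) (n * (k + 3) + 3) (I n)"
    unfolding For_def
    by (rule hoare_Seq[OF hoare_straight[where k = 1] loop[of n]]) (auto intro: stable init)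
  from this _ final k' show ?thesis by (rule hoare_conseq)
qed

section \<open>The program\<close>

text \<open>
  Memory layout, with scalars in column 0.
  Natural numbers: row 0 output, 1 total size, 2 schedule, 3 item set of value queries, 4 range \<open>N\<close>
  and 5 value \<open>r\<close> of the random draw, 6 random bit, 7 flag for covered starts, 8 and 9 items, 10 time
  counter, 11 layer of the table, 12 output position, 13 end time, \<open>20 + k\<close> and \<open>21 + n + k\<close> item
  (plus 1, with 0 for none) and end time of the \<open>r\<close>-th interval in layer \<open>k\<close> of the table of \<open>best\<close>.
  Reals: row 0 the power \<open>u\<^sup>k\<close> that controls the number of rounds, 1 and 2 scratch, \<open>3 + i\<close> weights of
  item \<open>i\<close> by end time, \<open>3 + n + k\<close> layer \<open>k\<close> of the table.
\<close>

abbreviation nle :: "nexp \<Rightarrow> nexp \<Rightarrow> bexp" where "nle a b \<equiv> BNot (NLess b a)"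
abbreviation neq :: "nexp \<Rightarrow> nexp \<Rightarrow> bexp" where "neq a b \<equiv> BAnd (nle a b) (nle b a)"

text \<open>Appends random bits to the drawn number while the range doubles from 2 to at least
  \<open>n + 2\<close>. A power of two is what makes the draw exactly uniform with a worst-case time
  bound.\<close>

definition draw :: com where
  "draw =
     Seq (Toss (Num 5) (Num 0)) (Seq (nassign 4 (Num 2))
       (Loop (NLess (nvar 4) (NAdd Items (Num 2)))
         (Seq (Toss (Num 6) (Num 0))
         (Seq (nassign 5 (NAdd (NAdd (nvar 5) (nvar 5)) (nvar 6)))
              (nassign 4 (NAdd (nvar 4) (nvar 4)))))))"

definition weigh_scan :: com where
  "weigh_scan = For 9 Items
     (Seq (Cond (nle (NAdd (NCell (Num 2) (nvar 9)) (SizeOf (nvar 9))) (nvar 13))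
            (NStore (Num 3) (nvar 9) (Num 1)) (NStore (Num 3) (nvar 9) (Num 0)))
          (Cond (BAnd (nle (NCell (Num 2) (nvar 9)) (NSub (nvar 13) (SizeOf (nvar 8))))
                  (NLess (NSub (nvar 13) (SizeOf (nvar 8)))
                    (NAdd (NCell (Num 2) (nvar 9)) (SizeOf (nvar 9)))))
            (nassign 7 (Num 1)) Skip))"

text \<open>A difference of consecutive tail queries yields the probability of one capacity; the two
  value queries, before and after inserting the item, yield the marginal.\<close>

definition weigh_store :: com where
  "weigh_store =
     Seq (rassign 2 (Value (Num 3)))
    (Seq (NStore (Num 3) (nvar 8) (Num 1))
    (Seq (rassign 1 (RAdd (rvar 1) (RMul (RSub (Tail (nvar 13)) (Tail (NAdd (nvar 13) (Num 1))))
           (RSub (Value (Num 3)) (rvar 2)))))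
         (Cond (BAnd (nle (SizeOf (nvar 8)) (nvar 13)) (NLess (nvar 7) (Num 1)))
           (RStore (NAdd (Num 3) (nvar 8)) (nvar 13) (rvar 1))
           (RStore (NAdd (Num 3) (nvar 8)) (nvar 13) (OfNat (Num 0))))))"

text \<open>End times are visited downwards from the total size, so the sum in \<open>gain\<close>
  grows by one summand per step. Recomputing it for each end time would make the running time
  quadratic in the total size.\<close>

definition weigh :: com where
  "weigh = For 8 Items
     (Seq (rassign 1 (OfNat (Num 0)))
       (For 10 (NAdd (nvar 1) (Num 1))
         (Seq (Seq (nassign 13 (NSub (nvar 1) (nvar 10))) (nassign 7 (Num 0)))
           (Seq weigh_scan weigh_store))))"

abbreviation value_row :: "nexp \<Rightarrow> nexp" where "value_row k \<equiv> NAdd (NAdd (Num 3) Items) k"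
abbreviation item_row :: "nexp \<Rightarrow> nexp" where "item_row k \<equiv> NAdd (Num 20) k"
abbreviation end_row :: "nexp \<Rightarrow> nexp" where "end_row k \<equiv> NAdd (NAdd (Num 21) Items) k"

definition store_entry :: "nexp \<Rightarrow> nexp \<Rightarrow> rexp \<Rightarrow> nexp \<Rightarrow> nexp \<Rightarrow> com" where
  "store_entry k t a i c = Seq (RStore (value_row k) t a)
     (Seq (NStore (item_row k) t i) (NStore (end_row k) t c))"

definition copy_entry :: "nexp \<Rightarrow> nexp \<Rightarrow> nexp \<Rightarrow> nexp \<Rightarrow> rexp \<Rightarrow> com" where
  "copy_entry k t k' t' a = store_entry k t (RAdd (RCell (value_row k') t') a)
     (NCell (item_row k') t') (NCell (end_row k') t')"

text \<open>Since \<open>r\<close> is drawn beforehand, each entry stores only the interval of index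
  \<open>r\<close> instead of a packing. That interval is the new one in the step from layer
  \<open>r\<close>; in other layers it is inherited from the entry that is extended.\<close>

definition table_item :: com where
  "table_item =
     (let k' = NAdd (nvar 11) (Num 1); t' = NAdd (nvar 10) (Num 1); p = NSub t' (SizeOf (nvar 8));
          w = RCell (NAdd (Num 3) (nvar 8)) t'; a = RAdd (RCell (value_row (nvar 11)) p) w in
      Cond (BAnd (nle (SizeOf (nvar 8)) t') (RLess (RCell (value_row k') t') a))
        (Cond (neq (nvar 11) (nvar 5)) (store_entry k' t' a (NAdd (nvar 8) (Num 1)) t')
           (copy_entry k' t' (nvar 11) p w))
        Skip)"

definition table_layer :: com where
  "table_layer =
     Seq (store_entry (NAdd (nvar 11) (Num 1)) (Num 0) (OfNat (Num 0)) (Num 0) (Num 0))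
       (For 10 (nvar 1)
         (Seq (copy_entry (NAdd (nvar 11) (Num 1)) (NAdd (nvar 10) (Num 1))
                 (NAdd (nvar 11) (Num 1)) (nvar 10) (OfNat (Num 0)))
              (For 8 Items table_item)))"

definition tabulate :: com where
  "tabulate =
     Seq (For 10 (NAdd (nvar 1) (Num 1)) (store_entry (Num 0) (nvar 10) (OfNat (Num 0)) (Num 0) (Num 0)))
         (For 11 Items table_layer)"

definition insert_pick :: com where
  "insert_pick =
     Cond (NLess (Num 0) (NCell (item_row Items) (nvar 1)))
       (Seq (Seq (nassign 8 (NSub (NCell (item_row Items) (nvar 1)) (Num 1)))
                 (nassign 13 (NCell (end_row Items) (nvar 1))))
         (Cond (RLess (OfNat (Num 0)) (RCell (NAdd (Num 3) (nvar 8)) (nvar 13)))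
           (Seq (For 9 Items
                  (Cond (BAnd (nle (NSub (nvar 13) (SizeOf (nvar 8))) (NCell (Num 2) (nvar 9)))
                          (NLess (NCell (Num 2) (nvar 9)) (nvar 13)))
                    (NStore (Num 2) (nvar 9) (nvar 1)) Skip))
                (NStore (Num 2) (nvar 8) (NSub (nvar 13) (SizeOf (nvar 8)))))
           Skip))
       Skip"

definition shrink :: com where
  "shrink = rassign 0 (RMul (rvar 0) (RSub (OfNat (Num 1)) (RDiv (OfNat (Num 1)) (OfNat (nvar 4)))))"

text \<open>The guard inspects the current power of \<open>1 - 1 / N\<close> and so stops after
  exactly \<open>rounds N\<close> rounds, without a counter.\<close>

definition iterate :: com where
  "iterate = Loop (RLess (RDiv (OfNat (Num 1)) (OfNat (Num 2))) (rvar 0))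
     (Seq draw (Seq weigh (Seq tabulate (Seq insert_pick shrink))))"

definition setup_plan :: com where
  "setup_plan =
     Seq (For 8 Items (nassign 1 (NAdd (nvar 1) (SizeOf (nvar 8)))))
    (Seq (For 8 Items (NStore (Num 2) (nvar 8) (nvar 1)))
         (rassign 0 (OfNat (Num 1))))"

definition emit :: com where
  "emit = Seq (nassign 12 (Num 0)) (For 10 (NAdd (nvar 1) (Num 1))
     (For 8 Items (Cond (neq (NCell (Num 2) (nvar 8)) (nvar 10))
        (Seq (NStore (Num 0) (nvar 12) (nvar 8)) (nassign 12 (NAdd (nvar 12) (Num 1)))) Skip)))"

definition algorithm :: com where
  "algorithm = Seq setup_plan (Seq iterate emit)"

section \<open>Verification of the weights\<close>

context valid_knapsack
begin

abbreviation "n \<equiv> items J"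
abbreviation "T \<equiv> total_size J"

definition state :: "(nat \<Rightarrow> nat) \<Rightarrow> nat \<Rightarrow> nat \<Rightarrow> real \<Rightarrow> memory \<Rightarrow> bool" where
  "state \<sigma> q r u m \<longleftrightarrow>
     nmem m 1 0 = T \<and> nmem m 2 = \<sigma> \<and> nmem m 4 0 = q \<and> nmem m 5 0 = r \<and> rmem m 0 0 = u"

lemma state_nstore [simp]:
  "a \<notin> {1, 2, 4, 5} \<Longrightarrow> state \<sigma> q r u (nstore a b v m) = state \<sigma> q r u m"
  by (simp add: state_def)

lemma state_rstore [simp]: "a \<noteq> 0 \<Longrightarrow> state \<sigma> q r u (rstore a b w m) = state \<sigma> q r u m"
  by (simp add: state_def)

lemma stateD:
  assumes "state \<sigma> q r u m"
  shows "nmem m 1 0 = T" "nmem m (Suc 0) 0 = T" "nmem m 2 = \<sigma>" "nmem m 4 0 = q" "nmem m 5 0 = r"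
    "rmem m 0 0 = u"
  using assms by (simp_all add: state_def)

lemma tail_diff:
  assumes "\<tau> \<le> T"
  shows "tail_oracle J \<tau> - tail_oracle J (Suc \<tau>) = pmf (cap J) \<tau>"
  using assms by (simp add: tail_oracle_def sum.atLeast_Suc_atMost)

definition scanned :: "(nat \<Rightarrow> nat) \<Rightarrow> nat \<Rightarrow> nat \<Rightarrow> nat \<Rightarrow> memory \<Rightarrow> bool" where
  "scanned \<sigma> i \<tau> j m \<longleftrightarrow>
     (\<forall>j'<j. (nmem m 3 j' \<noteq> 0) = (\<sigma> j' + size_of J j' \<le> \<tau>)) \<and>
     (nmem m 7 0 \<noteq> 0) = (\<exists>j'<j. \<sigma> j' \<le> \<tau> - size_of J i \<and> \<tau> - size_of J i < \<sigma> j' + size_of J j')"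

text \<open>\<open>t\<close> counts the processed end times of item \<open>i\<close>, from
  \<open>T\<close> downwards: the interval is empty for \<open>t = 0\<close> and becomes
  \<open>{0..T}\<close> for \<open>t = Suc T\<close>.\<close>

definition weighed :: "(nat \<Rightarrow> nat) \<Rightarrow> nat \<Rightarrow> nat \<Rightarrow> memory \<Rightarrow> bool" where
  "weighed \<sigma> i t m \<longleftrightarrow>
     (\<forall>i'<i. \<forall>c\<le>T. rmem m (3 + i') c = gain J \<sigma> i' c) \<and>
     (\<forall>c\<in>{Suc T - t..T}. rmem m (3 + i) c = gain J \<sigma> i c)"

definition accumulated :: "(nat \<Rightarrow> nat) \<Rightarrow> nat \<Rightarrow> nat \<Rightarrow> memory \<Rightarrow> bool" where
  "accumulated \<sigma> i t m \<longleftrightarrow>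
     rmem m 1 0 = (\<Sum>\<tau>=Suc T - t..T. pmf (cap J) \<tau> * marginal J \<sigma> i \<tau>)"

lemma weighed_nstore [simp]: "weighed \<sigma> i t (nstore a b v m) = weighed \<sigma> i t m"
  by (simp add: weighed_def)

lemma accumulated_nstore [simp]: "accumulated \<sigma> i t (nstore a b v m) = accumulated \<sigma> i t m"
  by (simp add: accumulated_def)

lemma weighed_rstore [simp]: "a < 3 \<Longrightarrow> weighed \<sigma> i t (rstore a b w m) = weighed \<sigma> i t m"
  by (simp add: weighed_def)

lemma weigh_scan:
  assumes i: "i < n"
  shows "hoare J
    (\<lambda>m. (state \<sigma> q r u m \<and> weighed \<sigma> i t m \<and> accumulated \<sigma> i t m \<and> nmem m 8 0 = i \<and>
       nmem m 10 0 = t \<and> nmem m 13 0 = \<tau>) \<and> nmem m 7 0 = 0)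
    weigh_scan (n * 10 + 3)
    (\<lambda>m. (state \<sigma> q r u m \<and> weighed \<sigma> i t m \<and> accumulated \<sigma> i t m \<and> nmem m 8 0 = i \<and>
       nmem m 10 0 = t \<and> nmem m 13 0 = \<tau>) \<and> scanned \<sigma> i \<tau> n m)"
  (is "hoare J (\<lambda>m. ?F m \<and> _) _ _ _")
  unfolding weigh_scan_def
proof (rule hoare_For[where n = n and k = 7 and I = "\<lambda>j m. ?F m \<and> scanned \<sigma> i \<tau> j m"])
  fix j assume j: "j < n"
  let ?set = "Cond (nle (NAdd (NCell (Num 2) (nvar 9)) (SizeOf (nvar 9))) (nvar 13))
            (NStore (Num 3) (nvar 9) (Num 1)) (NStore (Num 3) (nvar 9) (Num 0))"
  let ?flag = "Cond (BAnd (nle (NCell (Num 2) (nvar 9)) (NSub (nvar 13) (SizeOf (nvar 8))))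
                  (NLess (NSub (nvar 13) (SizeOf (nvar 8)))
                    (NAdd (NCell (Num 2) (nvar 9)) (SizeOf (nvar 9)))))
            (nassign 7 (Num 1)) Skip"
  show "hoare J (\<lambda>m. (?F m \<and> scanned \<sigma> i \<tau> j m) \<and> nmem m 9 0 = j) (Seq ?set ?flag) 7
     (\<lambda>m. (?F m \<and> scanned \<sigma> i \<tau> (Suc j) m) \<and> nmem m 9 0 = j)"
  proof (rule hoare_straight)
    fix m assume m: "(?F m \<and> scanned \<sigma> i \<tau> j m) \<and> nmem m 9 0 = j"
    let ?m1 = "nstore 3 j (of_bool (\<sigma> j + size_of J j \<le> \<tau>)) m"
    let ?c = "\<sigma> j \<le> \<tau> - size_of J i \<and> \<tau> - size_of J i < \<sigma> j + size_of J j"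
    have "nmem m 2 = \<sigma>" using m stateD by blast
    then have eff: "effect J (Seq ?set ?flag) m = (if ?c then nstore 7 0 1 ?m1 else ?m1)"
      using m i j by (simp add: item_set_def not_less)
    show "(?F (effect J (Seq ?set ?flag) m) \<and> scanned \<sigma> i \<tau> (Suc j) (effect J (Seq ?set ?flag) m)) \<and>
        nmem (effect J (Seq ?set ?flag) m) 9 0 = j"
      unfolding eff using m
      by (cases ?c; simp add: scanned_def All_less_Suc Ex_less_Suc; blast)
  qed simp_all
qed (simp_all add: scanned_def)

lemma weigh_store:
  assumes i: "i < n" and t: "t \<le> T"
  shows "hoare J
    (\<lambda>m. (state \<sigma> q r u m \<and> weighed \<sigma> i t m \<and> accumulated \<sigma> i t m \<and> nmem m 8 0 = i \<and>
       nmem m 10 0 = t \<and> nmem m 13 0 = T - t) \<and> scanned \<sigma> i (T - t) n m)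
    weigh_store 10
    (\<lambda>m. (state \<sigma> q r u m \<and> weighed \<sigma> i (Suc t) m \<and> accumulated \<sigma> i (Suc t) m \<and> nmem m 8 0 = i) \<and>
       nmem m 10 0 = t)"
proof (rule hoare_straight)
  fix m assume m: "(state \<sigma> q r u m \<and> weighed \<sigma> i t m \<and> accumulated \<sigma> i t m \<and> nmem m 8 0 = i \<and>
       nmem m 10 0 = t \<and> nmem m 13 0 = T - t) \<and> scanned \<sigma> i (T - t) n m"
  let ?\<tau> = "T - t"
  have iset: "i \<in> item_set J" using i by (simp add: item_set_def)
  have A: "{j \<in> item_set J. 0 < nmem m 3 j} = completed J \<sigma> ?\<tau>"
    using m by (auto simp: scanned_def completed_def item_set_def)
  have A': "{j \<in> item_set J. 0 < ((nmem m 3)(i := Suc 0)) j} = insert i (completed J \<sigma> ?\<tau>)"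
    using A iset by auto
  have cov: "(nmem m 7 0 \<noteq> 0) = covered J \<sigma> (?\<tau> - size_of J i)"
    using m by (auto simp: scanned_def covered_def item_set_def)
  define S where "S = {Suc T - t..T}"
  have range: "{Suc T - Suc t..T} = insert ?\<tau> S" "?\<tau> \<notin> S" "finite S"
    using t by (auto simp: S_def)
  let ?new = "\<Sum>\<tau>=Suc T - Suc t..T. pmf (cap J) \<tau> * marginal J \<sigma> i \<tau>"
  have "rmem m 1 0 = (\<Sum>\<tau>\<in>S. pmf (cap J) \<tau> * marginal J \<sigma> i \<tau>)"
    using m by (simp only: accumulated_def S_def)
  then have acc: "?new = rmem m 1 0 + (tail_oracle J ?\<tau> - tail_oracle J (Suc ?\<tau>)) *
      (val J (insert i (completed J \<sigma> ?\<tau>)) - val J (completed J \<sigma> ?\<tau>))"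
    unfolding range(1) using range(2,3) tail_diff[of ?\<tau>] by (simp add: marginal_def)
  have "Suc T - Suc t = ?\<tau>" by simp
  then have gain: "gain J \<sigma> i ?\<tau> = (if size_of J i \<le> ?\<tau> \<and> nmem m 7 0 = 0 then ?new else 0)"
    using cov by (auto simp: gain_def)
  have eff: "effect J weigh_store m = rstore (3 + i) ?\<tau> (gain J \<sigma> i ?\<tau>)
      (rstore 1 0 ?new (nstore 3 i 1 (rstore 2 0 (val J (completed J \<sigma> ?\<tau>)) m)))"
    using m iset unfolding gain acc
    by (simp add: weigh_store_def A A' not_less fun_upd_same del: fun_upd_apply)
  have "weighed \<sigma> i (Suc t) (effect J weigh_store m)"
    unfolding weighed_def
  proof (intro conjI allI impI ballI)
    fix i' c assume "i' < i" "c \<le> T"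
    then show "rmem (effect J weigh_store m) (3 + i') c = gain J \<sigma> i' c"
      using m by (simp add: eff weighed_def)
  next
    fix c assume "c \<in> {Suc T - Suc t..T}"
    then have "c = ?\<tau> \<or> c \<noteq> ?\<tau> \<and> c \<in> {Suc T - t..T}" by auto
    then show "rmem (effect J weigh_store m) (3 + i) c = gain J \<sigma> i c"
      using m by (auto simp: eff weighed_def simp del: atLeastAtMost_iff)
  qed
  moreover have "accumulated \<sigma> i (Suc t) (effect J weigh_store m)"
    by (simp add: accumulated_def eff)
  ultimately show "(state \<sigma> q r u (effect J weigh_store m) \<and>
      weighed \<sigma> i (Suc t) (effect J weigh_store m) \<and>
      accumulated \<sigma> i (Suc t) (effect J weigh_store m) \<and> nmem (effect J weigh_store m) 8 0 = i) \<and>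
      nmem (effect J weigh_store m) 10 0 = t"
    using m by (simp add: eff state_def)
qed (simp_all add: weigh_store_def)

lemma weigh:
  "hoare J (state \<sigma> q r u) weigh (n * ((T + 1) * (n * 10 + 23) + 10) + 3)
     (\<lambda>m. state \<sigma> q r u m \<and> (\<forall>i<n. \<forall>c\<le>T. rmem m (3 + i) c = gain J \<sigma> i c))"
  unfolding weigh_def
proof (rule hoare_For[where n = n and k = "(T + 1) * (n * 10 + 23) + 5"
      and I = "\<lambda>i m. state \<sigma> q r u m \<and> weighed \<sigma> i 0 m"])
  fix i assume i: "i < n"
  let ?S = "Seq (Seq (nassign 13 (NSub (nvar 1) (nvar 10))) (nassign 7 (Num 0)))
           (Seq weigh_scan weigh_store)"
  let ?I = "\<lambda>t m. state \<sigma> q r u m \<and> weighed \<sigma> i t m \<and> accumulated \<sigma> i t m \<and> nmem m 8 0 = i"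
  have inner: "hoare J (\<lambda>m. state \<sigma> q r u m \<and> weighed \<sigma> i 0 m \<and> accumulated \<sigma> i 0 m \<and> nmem m 8 0 = i)
      (For 10 (NAdd (nvar 1) (Num 1)) ?S) ((T + 1) * (n * 10 + 23) + 3)
      (\<lambda>m. (state \<sigma> q r u m \<and> weighed \<sigma> (Suc i) 0 m) \<and> nmem m 8 0 = i)"
  proof (rule hoare_For[where n = "T + 1" and k = "n * 10 + 20" and I = ?I])
    fix t assume t: "t < T + 1"
    show "hoare J (\<lambda>m. ?I t m \<and> nmem m 10 0 = t) ?S (n * 10 + 20)
        (\<lambda>m. ?I (Suc t) m \<and> nmem m 10 0 = t)"
    proof (rule hoare_Seq[OF _ hoare_Seq[OF weigh_scan[OF i] weigh_store[OF i]]])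
      show "hoare J (\<lambda>m. ?I t m \<and> nmem m 10 0 = t)
         (Seq (nassign 13 (NSub (nvar 1) (nvar 10))) (nassign 7 (Num 0))) 3
         (\<lambda>m. (state \<sigma> q r u m \<and> weighed \<sigma> i t m \<and> accumulated \<sigma> i t m \<and> nmem m 8 0 = i \<and>
            nmem m 10 0 = t \<and> nmem m 13 0 = T - t) \<and> nmem m 7 0 = 0)"
        by (rule hoare_straight) (auto dest: stateD(2))
    qed (use t in auto)
  qed (auto dest: stateD(2) simp: weighed_def less_Suc_eq)
  show "hoare J (\<lambda>m. (state \<sigma> q r u m \<and> weighed \<sigma> i 0 m) \<and> nmem m 8 0 = i)
      (Seq (rassign 1 (OfNat (Num 0))) (For 10 (NAdd (nvar 1) (Num 1)) ?S))
      ((T + 1) * (n * 10 + 23) + 5)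
      (\<lambda>m. (state \<sigma> q r u m \<and> weighed \<sigma> (Suc i) 0 m) \<and> nmem m 8 0 = i)"
  proof (rule hoare_Seq[OF hoare_straight[where k = 1] inner])
    show "Suc (1 + ((T + 1) * (n * 10 + 23) + 3)) \<le> (T + 1) * (n * 10 + 23) + 5" by linarith
  qed (auto simp: accumulated_def)
next
  show "n * ((T + 1) * (n * 10 + 23) + 5 + 3) + 3 \<le> n * ((T + 1) * (n * 10 + 23) + 10) + 3"
    by (intro add_right_mono mult_left_mono) auto
qed (auto simp: weighed_def)

end

section \<open>Correctness of the program\<close>

lemma uniform_double:
  fixes k :: nat
  assumes "0 < k"
  shows "pmf_of_set {..<2 * k} =
    bind_pmf (bernoulli_pmf (1 / 2)) (\<lambda>b. map_pmf (\<lambda>x. of_bool b * k + x) (pmf_of_set {..<k}))"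
proof (rule pmf_eqI)
  fix x
  have shift: "map_pmf (\<lambda>x. c + x) (pmf_of_set {..<k}) = pmf_of_set {c..<c + k}" for c
  proof -
    have "(\<lambda>x. c + x) ` {..<k} = {c..<c + k}"
      by (simp add: lessThan_atLeast0 add.commute)
    then show ?thesis using assms by (subst map_pmf_of_set_inj) auto
  qed
  have ne: "{..<2 * k} \<noteq> {}" using assms by (auto simp: lessThan_empty_iff)
  \<comment> \<open>The bit selects the upper or lower half, so it acts as the leading binary
    digit.\<close>
  have "pmf (pmf_of_set {..<2 * k}) x =
      1 / 2 * pmf (pmf_of_set {k..<k + k}) x + 1 / 2 * pmf (pmf_of_set {0..<k}) x"
    using assms by (auto simp: pmf_of_set[OF ne] pmf_of_set indicator_def)
  also have "\<dots> = pmf (bind_pmf (bernoulli_pmf (1 / 2))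
      (\<lambda>b. map_pmf (\<lambda>x. of_bool b * k + x) (pmf_of_set {..<k}))) x"
  proof -
    have "(+) (0 :: nat) = id" by (simp add: fun_eq_iff)
    moreover have "map_pmf (\<lambda>x. of_bool True * k + x) (pmf_of_set {..<k}) = pmf_of_set {k..<k + k}"
      using shift[of k] by simp
    ultimately show ?thesis by (simp add: pmf_bind lessThan_atLeast0)
  qed
  finally show "pmf (pmf_of_set {..<2 * k}) x = pmf (bind_pmf (bernoulli_pmf (1 / 2))
      (\<lambda>b. map_pmf (\<lambda>x. of_bool b * k + x) (pmf_of_set {..<k}))) x" .
qed

text \<open>The number of iterations of the loop in \<open>draw\<close>; the toss before the loop
  accounts for the successor in \<open>draw_range\<close>.\<close>

definition draw_exponent :: "nat \<Rightarrow> nat" where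
  "draw_exponent n = (LEAST l. n + 2 \<le> 2 ^ Suc l)"

definition draw_range :: "nat \<Rightarrow> nat" where
  "draw_range n = 2 ^ Suc (draw_exponent n)"

lemma draw_exponent:
  "n + 2 \<le> draw_range n" "l < draw_exponent n \<Longrightarrow> 2 ^ Suc l < n + 2" "draw_exponent n \<le> n"
proof -
  have ex: "n + 2 \<le> 2 ^ Suc n" by (induction n) auto
  then show "n + 2 \<le> draw_range n"
    unfolding draw_range_def draw_exponent_def by (rule LeastI)
  show "2 ^ Suc l < n + 2" if "l < draw_exponent n"
    using not_less_Least[OF that[unfolded draw_exponent_def]] by simp
  show "draw_exponent n \<le> n" unfolding draw_exponent_def using ex by (rule Least_le)
qed

text \<open>The last doubling started below \<open>n + 2\<close>. A range linear in \<open>n\<close>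
  keeps the number of rounds linear as well.\<close>

lemma draw_range_le: "draw_range n \<le> 2 * n + 4"
proof (cases "draw_exponent n")
  case (Suc l)
  then show ?thesis using draw_exponent(2)[of l n] by (simp add: draw_range_def)
qed (simp add: draw_range_def)

definition draw_frame :: "memory \<Rightarrow> memory \<Rightarrow> bool" where
  "draw_frame m m' \<longleftrightarrow> (\<forall>x. x \<notin> {4, 5, 6} \<longrightarrow> nmem m' x = nmem m x) \<and> rmem m' = rmem m"

lemma draw_frame_trans: "draw_frame m m' \<Longrightarrow> draw_frame m' m'' \<Longrightarrow> draw_frame m m''"
  by (simp add: draw_frame_def)

text \<open>Induction on the remaining iterations \<open>d\<close>: the bits drawn so far are the
  leading ones, and the \<open>d\<close> missing bits contribute a uniform summand.\<close>

lemma draw_loop: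
  assumes "d \<le> draw_exponent (items J)" "nmem m 4 0 = 2 ^ Suc (draw_exponent (items J) - d)"
  shows "\<exists>M. runs J (Loop (NLess (nvar 4) (NAdd Items (Num 2)))
         (Seq (Toss (Num 6) (Num 0))
         (Seq (nassign 5 (NAdd (NAdd (nvar 5) (nvar 5)) (nvar 6)))
              (nassign 4 (NAdd (nvar 4) (nvar 4)))))) m M (d * 6 + 1) \<and>
    map_pmf (\<lambda>m. nmem m 5 0) M = map_pmf (\<lambda>x. nmem m 5 0 * 2 ^ d + x) (pmf_of_set {..<2 ^ d}) \<and>
    (\<forall>m'\<in>set_pmf M. nmem m' 4 0 = draw_range (items J) \<and> draw_frame m m')"
  (is "\<exists>M. runs J ?L m M _ \<and> _")
  using assms
proof (induction d arbitrary: m)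
  case 0
  have "\<not> beval J (NLess (nvar 4) (NAdd Items (Num 2))) m"
    using 0 draw_exponent(1)[of "items J"] by (simp add: draw_range_def)
  from runs_Loop_False[OF this] show ?case
    using 0 by (intro exI[of _ "return_pmf m"])
      (simp add: draw_range_def draw_frame_def pmf_of_set_singleton lessThan_Suc)
next
  case (Suc d)
  let ?e = "draw_exponent (items J)" and ?r = "nmem m 5 0"
  let ?b = "Seq (nassign 5 (NAdd (NAdd (nvar 5) (nvar 5)) (nvar 6))) (nassign 4 (NAdd (nvar 4) (nvar 4)))"
  let ?f = "\<lambda>z. nstore 6 0 (of_bool z) m"
  let ?g = "\<lambda>z. effect J ?b (?f z)"
  have "runs J (Toss (Num 6) (Num 0)) m (map_pmf ?f (bernoulli_pmf (1 / 2))) 1"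
    using runs_Toss[of J "Num 6" "Num 0" m] by simp
  from runs_Seq[OF this runs_straight[of ?b]]
  have body: "runs J (Seq (Toss (Num 6) (Num 0)) ?b) m (map_pmf ?g (bernoulli_pmf (1 / 2))) 5"
    by (simp add: map_pmf_def bind_assoc_pmf bind_return_pmf eval_nat_numeral)
  have guard: "beval J (NLess (nvar 4) (NAdd Items (Num 2))) m"
    using Suc.prems draw_exponent(2)[of "?e - Suc d" "items J"] by simp
  have "Suc (?e - Suc d) = ?e - d" using Suc.prems by simp
  then have g4: "nmem (?g z) 4 0 = 2 ^ Suc (?e - d)" for z
    using Suc.prems(2) by (simp flip: mult_2)
  have g5: "nmem (?g z) 5 0 = 2 * ?r + of_bool z" for z by simp
  have gf: "draw_frame m (?g z)" for z by (simp add: draw_frame_def)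
  have "\<forall>z. \<exists>M. runs J ?L (?g z) M (d * 6 + 1) \<and>
      map_pmf (\<lambda>m. nmem m 5 0) M =
        map_pmf (\<lambda>x. nmem (?g z) 5 0 * 2 ^ d + x) (pmf_of_set {..<2 ^ d}) \<and>
      (\<forall>m'\<in>set_pmf M. nmem m' 4 0 = draw_range (items J) \<and> draw_frame (?g z) m')"
    using Suc.IH[OF _ g4] Suc.prems(1) by simp
  then obtain N where N: "\<And>z. runs J ?L (?g z) (N z) (d * 6 + 1)"
    "\<And>z. map_pmf (\<lambda>m. nmem m 5 0) (N z) =
        map_pmf (\<lambda>x. nmem (?g z) 5 0 * 2 ^ d + x) (pmf_of_set {..<2 ^ d})"
    "\<And>z m'. m' \<in> set_pmf (N z) \<Longrightarrow> nmem m' 4 0 = draw_range (items J) \<and> draw_frame (?g z) m'"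
    unfolding choice_iff by blast
  \<comment> \<open>The rule for loops wants the continuation as a function of the memory; the bit
    is recovered from row 6, where the toss left it.\<close>
  define N' where "N' = (\<lambda>m' :: memory. N (nmem m' 6 0 \<noteq> 0))"
  have N': "N' (?g z) = N z" for z by (simp add: N'_def)
  let ?M = "bind_pmf (map_pmf ?g (bernoulli_pmf (1 / 2))) N'"
  have M: "?M = bind_pmf (bernoulli_pmf (1 / 2)) N"
    unfolding bind_map_pmf N' ..
  have "runs J ?L m ?M (Suc (5 + (d * 6 + 1)))"
  proof (rule runs_Loop_True[OF guard body])
    fix m' assume "m' \<in> set_pmf (map_pmf ?g (bernoulli_pmf (1 / 2)))"
    then obtain z where "m' = ?g z" by auto
    then show "runs J ?L m' (N' m') (d * 6 + 1)" using N(1) N' by metis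
  qed
  then have "runs J ?L m ?M (Suc d * 6 + 1)" by (rule runs_weaken) simp
  moreover have "map_pmf (\<lambda>m. nmem m 5 0) ?M =
      map_pmf (\<lambda>x. ?r * 2 ^ Suc d + x) (pmf_of_set {..<2 ^ Suc d})"
  proof -
    have "map_pmf (\<lambda>m. nmem m 5 0) ?M = bind_pmf (bernoulli_pmf (1 / 2))
        (\<lambda>z. map_pmf (\<lambda>x. (2 * ?r + of_bool z) * 2 ^ d + x) (pmf_of_set {..<2 ^ d}))"
      unfolding M map_bind_pmf N(2) g5 ..
    also have "\<dots> = map_pmf (\<lambda>x. ?r * 2 ^ Suc d + x) (bind_pmf (bernoulli_pmf (1 / 2))
        (\<lambda>z. map_pmf (\<lambda>x. of_bool z * 2 ^ d + x) (pmf_of_set {..<2 ^ d})))"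
      by (simp add: map_bind_pmf pmf.map_comp o_def algebra_simps)
    also have "\<dots> = map_pmf (\<lambda>x. ?r * 2 ^ Suc d + x) (pmf_of_set {..<2 ^ Suc d})"
      using uniform_double[of "2 ^ d"] by simp
    finally show ?thesis .
  qed
  moreover have "\<forall>m'\<in>set_pmf ?M. nmem m' 4 0 = draw_range (items J) \<and> draw_frame m m'"
    unfolding M using N(3) gf draw_frame_trans by fastforce
  ultimately show ?case by blast
qed

lemma draw:
  "\<exists>M. runs J draw m M (draw_exponent (items J) * 6 + 5) \<and>
    map_pmf (\<lambda>m. nmem m 5 0) M = pmf_of_set {..<draw_range (items J)} \<and>
    (\<forall>m'\<in>set_pmf M. nmem m' 4 0 = draw_range (items J) \<and> draw_frame m m')"
proof -
  let ?e = "draw_exponent (items J)"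
  let ?L = "Loop (NLess (nvar 4) (NAdd Items (Num 2)))
         (Seq (Toss (Num 6) (Num 0))
         (Seq (nassign 5 (NAdd (NAdd (nvar 5) (nvar 5)) (nvar 6)))
              (nassign 4 (NAdd (nvar 4) (nvar 4)))))"
  let ?f = "\<lambda>z. nstore 5 0 (of_bool z) m" and ?g = "\<lambda>z. nstore 4 0 2 (nstore 5 0 (of_bool z) m)"
  have "\<forall>z. \<exists>M. runs J ?L (?g z) M (?e * 6 + 1) \<and>
      map_pmf (\<lambda>m. nmem m 5 0) M =
        map_pmf (\<lambda>x. nmem (?g z) 5 0 * 2 ^ ?e + x) (pmf_of_set {..<2 ^ ?e}) \<and>
      (\<forall>m'\<in>set_pmf M. nmem m' 4 0 = draw_range (items J) \<and> draw_frame (?g z) m')"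
    by (intro allI draw_loop) auto
  then obtain N where N: "\<And>z. runs J ?L (?g z) (N z) (?e * 6 + 1)"
    "\<And>z. map_pmf (\<lambda>m. nmem m 5 0) (N z) =
        map_pmf (\<lambda>x. nmem (?g z) 5 0 * 2 ^ ?e + x) (pmf_of_set {..<2 ^ ?e})"
    "\<And>z m'. m' \<in> set_pmf (N z) \<Longrightarrow> nmem m' 4 0 = draw_range (items J) \<and> draw_frame (?g z) m'"
    unfolding choice_iff by blast
  define N' where "N' = (\<lambda>m' :: memory. N (nmem m' 5 0 \<noteq> 0))"
  let ?M = "bind_pmf (map_pmf ?f (bernoulli_pmf (1 / 2))) N'"
  have M: "?M = bind_pmf (bernoulli_pmf (1 / 2)) N"
    by (simp add: bind_map_pmf N'_def)
  have "runs J draw m ?M (Suc (1 + Suc (1 + (?e * 6 + 1))))"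
    unfolding draw_def
  proof (rule runs_Seq)
    show "runs J (Toss (Num 5) (Num 0)) m (map_pmf ?f (bernoulli_pmf (1 / 2))) 1"
      using runs_Toss[of J "Num 5" "Num 0" m] by simp
  next
    fix m' assume "m' \<in> set_pmf (map_pmf ?f (bernoulli_pmf (1 / 2)))"
    then obtain z where z: "m' = ?f z" by auto
    have "runs J (Seq (nassign 4 (Num 2)) ?L) m' (bind_pmf (return_pmf (?g z)) (\<lambda>_. N z))
        (Suc (1 + (?e * 6 + 1)))"
      using runs_straight[of "nassign 4 (Num 2)" J m'] N(1)[of z] z by (intro runs_Seq) auto
    then show "runs J (Seq (nassign 4 (Num 2)) ?L) m' (N' m') (Suc (1 + (?e * 6 + 1)))"
      using z by (simp add: bind_return_pmf N'_def)
  qed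
  then have "runs J draw m ?M (?e * 6 + 5)" by (rule runs_weaken) simp
  moreover have "map_pmf (\<lambda>m. nmem m 5 0) ?M = pmf_of_set {..<draw_range (items J)}"
    using uniform_double[of "2 ^ ?e"] unfolding M map_bind_pmf N(2) by (simp add: draw_range_def)
  moreover have "draw_frame m (?g z)" for z by (simp add: draw_frame_def)
  then have "\<forall>m'\<in>set_pmf ?M. nmem m' 4 0 = draw_range (items J) \<and> draw_frame m m'"
    unfolding M using N(3) draw_frame_trans by fastforce
  ultimately show ?thesis by blast
qed

section \<open>Verification of the table and of the insertion\<close>

definition pick_item :: "(nat \<times> nat) option \<Rightarrow> nat" where
  "pick_item e = (case e of None \<Rightarrow> 0 | Some (i, c) \<Rightarrow> Suc i)"

definition pick_end :: "(nat \<times> nat) option \<Rightarrow> nat" where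
  "pick_end e = (case e of None \<Rightarrow> 0 | Some (i, c) \<Rightarrow> c)"

lemma pick_simps [simp]:
  "pick_item None = 0" "pick_item (Some (i, c)) = Suc i" "pick_end None = 0" "pick_end (Some (i, c)) = c"
  by (simp_all add: pick_item_def pick_end_def)

context valid_knapsack
begin

definition put :: "nat \<Rightarrow> nat \<Rightarrow> real \<Rightarrow> nat \<Rightarrow> nat \<Rightarrow> memory \<Rightarrow> memory" where
  "put k t a i c m = nstore (21 + n + k) t c (nstore (20 + k) t i (rstore (3 + n + k) t a m))"

text \<open>Relates an entry of the table to the value of \<open>best\<close> and to component
  \<open>r\<close> of its packing, the only component kept in memory.\<close>

definition entry :: "nat \<Rightarrow> memory \<Rightarrow> nat \<Rightarrow> nat \<Rightarrow> real \<times> (nat \<Rightarrow> (nat \<times> nat) option) \<Rightarrow> bool" where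
  "entry r m k t b \<longleftrightarrow> rmem m (3 + n + k) t = fst b \<and> nmem m (20 + k) t = pick_item (snd b r) \<and>
     nmem m (21 + n + k) t = pick_end (snd b r)"

definition weights_stored :: "(nat \<Rightarrow> nat \<Rightarrow> real) \<Rightarrow> memory \<Rightarrow> bool" where
  "weights_stored w m \<longleftrightarrow> (\<forall>i<n. \<forall>c\<le>T. rmem m (3 + i) c = w i c)"

text \<open>The bounds on the layers keep the rows apart: \<open>20 + k'\<close> equals
  \<open>21 + n + k\<close> only for \<open>k' > n\<close>.\<close>

lemma entry_put:
  assumes "k \<le> n" "k' \<le> n"
  shows "entry r (put k t a i c m) k' t' b \<longleftrightarrow>
    (if k' = k \<and> t' = t then a = fst b \<and> i = pick_item (snd b r) \<and> c = pick_end (snd b r)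
     else entry r m k' t' b)"
  using assms by (auto simp: entry_def put_def)

lemma entry_nstore [simp]: "x < 20 \<Longrightarrow> entry r (nstore x y v m) k t b = entry r m k t b"
  by (simp add: entry_def)

lemma put_simps [simp]:
  "state \<sigma> q r u (put k t a i c m) = state \<sigma> q r u m"
  "weights_stored w (put k t a i c m) = weights_stored w m"
  "x < 20 \<Longrightarrow> nmem (put k t a i c m) x = nmem m x"
  by (auto simp: put_def weights_stored_def)

lemma weights_stored_nstore [simp]: "weights_stored w (nstore x y v m) = weights_stored w m"
  by (simp add: weights_stored_def)

lemma tabulate_init:
  "hoare J (\<lambda>m. state \<sigma> q r u m \<and> weights_stored w m)
     (For 10 (NAdd (nvar 1) (Num 1)) (store_entry (Num 0) (nvar 10) (OfNat (Num 0)) (Num 0) (Num 0)))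
     ((T + 1) * 8 + 3)
     (\<lambda>m. state \<sigma> q r u m \<and> weights_stored w m \<and> (\<forall>t\<le>T. entry r m 0 t (best J w 0 t)))"
proof (rule hoare_For[where n = "T + 1" and k = 5 and
      I = "\<lambda>t m. state \<sigma> q r u m \<and> weights_stored w m \<and> (\<forall>t'<t. entry r m 0 t' (best J w 0 t'))"])
  fix t assume t: "t < T + 1"
  let ?c = "store_entry (Num 0) (nvar 10) (OfNat (Num 0)) (Num 0) (Num 0)"
  show "hoare J (\<lambda>m. (state \<sigma> q r u m \<and> weights_stored w m \<and>
        (\<forall>t'<t. entry r m 0 t' (best J w 0 t'))) \<and> nmem m 10 0 = t) ?c 5
      (\<lambda>m. (state \<sigma> q r u m \<and> weights_stored w m \<and>
        (\<forall>t'<Suc t. entry r m 0 t' (best J w 0 t'))) \<and> nmem m 10 0 = t)"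
  proof (rule hoare_straight)
    fix m assume m: "(state \<sigma> q r u m \<and> weights_stored w m \<and>
        (\<forall>t'<t. entry r m 0 t' (best J w 0 t'))) \<and> nmem m 10 0 = t"
    have "effect J ?c m = put 0 t 0 0 0 m" using m by (simp add: store_entry_def put_def)
    then show "(state \<sigma> q r u (effect J ?c m) \<and> weights_stored w (effect J ?c m) \<and>
        (\<forall>t'<Suc t. entry r (effect J ?c m) 0 t' (best J w 0 t'))) \<and> nmem (effect J ?c m) 10 0 = t"
      using m by (auto simp: entry_put less_Suc_eq)
  qed (simp_all add: store_entry_def)
qed (auto dest: stateD(2) simp: less_Suc_eq_le)

text \<open>Simulates a single \<open>improve\<close>; \<open>b\<close> is the accumulator of the
  fold in \<open>best\<close>, held in the entry under construction.\<close>

lemma table_item: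
  assumes k: "k < n" and t: "t < T" and i: "i < n"
  shows "hoare J (\<lambda>m. (state \<sigma> q r u m \<and> weights_stored w m \<and>
        (\<forall>t'\<le>T. entry r m k t' (best J w k t')) \<and>
        (\<forall>t'\<le>t. entry r m (Suc k) t' (best J w (Suc k) t')) \<and> nmem m 11 0 = k \<and> nmem m 10 0 = t \<and>
        entry r m (Suc k) (Suc t) b) \<and> nmem m 8 0 = i)
      table_item 15
      (\<lambda>m. (state \<sigma> q r u m \<and> weights_stored w m \<and>
        (\<forall>t'\<le>T. entry r m k t' (best J w k t')) \<and>
        (\<forall>t'\<le>t. entry r m (Suc k) t' (best J w (Suc k) t')) \<and> nmem m 11 0 = k \<and> nmem m 10 0 = t \<and>
        entry r m (Suc k) (Suc t) (improve J w k (Suc t) (best J w k) i b)) \<and> nmem m 8 0 = i)"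
    (is "hoare J (\<lambda>m. (?F m \<and> _) \<and> _) _ _ _")
proof (rule hoare_straight)
  fix m assume m: "(state \<sigma> q r u m \<and> weights_stored w m \<and>
        (\<forall>t'\<le>T. entry r m k t' (best J w k t')) \<and>
        (\<forall>t'\<le>t. entry r m (Suc k) t' (best J w (Suc k) t')) \<and> nmem m 11 0 = k \<and> nmem m 10 0 = t \<and>
        entry r m (Suc k) (Suc t) b) \<and> nmem m 8 0 = i"
  let ?p = "Suc t - size_of J i"
  let ?a = "best J w k ?p"
  let ?better = "size_of J i \<le> Suc t \<and> fst b < fst ?a + w i (Suc t)"
  have iset: "i \<in> item_set J" using i by (simp add: item_set_def)
  have p: "entry r m k ?p ?a" and b: "entry r m (Suc k) (Suc t) b" using m t by auto
  have w: "rmem m (3 + i) (Suc t) = w i (Suc t)" using m t i by (simp add: weights_stored_def)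
  have "state \<sigma> q r u m" using m by blast
  then have r: "nmem m 5 0 = r" by (rule stateD)
  have eff: "effect J table_item m =
      (if ?better then
        if k = r then put (Suc k) (Suc t) (fst ?a + w i (Suc t)) (Suc i) (Suc t) m
        else put (Suc k) (Suc t) (fst ?a + w i (Suc t)) (pick_item (snd ?a r)) (pick_end (snd ?a r)) m
       else m)"
    using m iset p b w r k
    by (auto simp: table_item_def Let_def store_entry_def copy_entry_def put_def entry_def
        not_less eval_nat_numeral(3)[symmetric])
  show "(state \<sigma> q r u (effect J table_item m) \<and> weights_stored w (effect J table_item m) \<and>
        (\<forall>t'\<le>T. entry r (effect J table_item m) k t' (best J w k t')) \<and>
        (\<forall>t'\<le>t. entry r (effect J table_item m) (Suc k) t' (best J w (Suc k) t')) \<and>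
        nmem (effect J table_item m) 11 0 = k \<and> nmem (effect J table_item m) 10 0 = t \<and>
        entry r (effect J table_item m) (Suc k) (Suc t) (improve J w k (Suc t) (best J w k) i b)) \<and>
        nmem (effect J table_item m) 8 0 = i"
    unfolding eff using m k
    by (cases ?better; cases "k = r"; simp add: entry_put improve_def Let_def; blast)
qed (simp_all add: table_item_def Let_def store_entry_def copy_entry_def)

lemma table_layer:
  assumes k: "k < n"
  shows "hoare J (\<lambda>m. (state \<sigma> q r u m \<and> weights_stored w m \<and>
        (\<forall>t\<le>T. entry r m k t (best J w k t))) \<and> nmem m 11 0 = k)
      table_layer (T * (n * 18 + 12) + 9)
      (\<lambda>m. (state \<sigma> q r u m \<and> weights_stored w m \<and>
        (\<forall>t\<le>T. entry r m (Suc k) t (best J w (Suc k) t))) \<and> nmem m 11 0 = k)"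
proof -
  let ?I = "\<lambda>t m. state \<sigma> q r u m \<and> weights_stored w m \<and>
        (\<forall>t'\<le>T. entry r m k t' (best J w k t')) \<and>
        (\<forall>t'\<le>t. entry r m (Suc k) t' (best J w (Suc k) t')) \<and> nmem m 11 0 = k"
  let ?z = "store_entry (NAdd (nvar 11) (Num 1)) (Num 0) (OfNat (Num 0)) (Num 0) (Num 0)"
  let ?c = "copy_entry (NAdd (nvar 11) (Num 1)) (NAdd (nvar 10) (Num 1))
              (NAdd (nvar 11) (Num 1)) (nvar 10) (OfNat (Num 0))"
  have zero: "hoare J (\<lambda>m. (state \<sigma> q r u m \<and> weights_stored w m \<and>
        (\<forall>t\<le>T. entry r m k t (best J w k t))) \<and> nmem m 11 0 = k) ?z 5 (?I 0)"
  proof (rule hoare_straight)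
    fix m assume m: "(state \<sigma> q r u m \<and> weights_stored w m \<and>
        (\<forall>t\<le>T. entry r m k t (best J w k t))) \<and> nmem m 11 0 = k"
    then have "effect J ?z m = put (Suc k) 0 0 0 0 m" by (simp add: store_entry_def put_def)
    then show "?I 0 (effect J ?z m)" using m k by (simp add: entry_put)
  qed (simp_all add: store_entry_def)
  have cell: "hoare J (\<lambda>m. ?I t m \<and> nmem m 10 0 = t) (Seq ?c (For 8 Items table_item)) (n * 18 + 9)
      (\<lambda>m. ?I (Suc t) m \<and> nmem m 10 0 = t)" if t: "t < T" for t
  proof (rule hoare_Seq)
    let ?b = "\<lambda>i. fold (improve J w k (Suc t) (best J w k)) [0..<i] (best J w (Suc k) t)"
    show "hoare J (\<lambda>m. ?I t m \<and> nmem m 10 0 = t) ?c 5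
        (\<lambda>m. state \<sigma> q r u m \<and> weights_stored w m \<and>
          (\<forall>t'\<le>T. entry r m k t' (best J w k t')) \<and>
          (\<forall>t'\<le>t. entry r m (Suc k) t' (best J w (Suc k) t')) \<and> nmem m 11 0 = k \<and>
          nmem m 10 0 = t \<and> entry r m (Suc k) (Suc t) (?b 0))"
    proof (rule hoare_straight)
      fix m assume m: "?I t m \<and> nmem m 10 0 = t"
      let ?a = "best J w (Suc k) t"
      have "entry r m (Suc k) t ?a" using m by blast
      then have eff: "effect J ?c m =
          put (Suc k) (Suc t) (fst ?a) (pick_item (snd ?a r)) (pick_end (snd ?a r)) m"
        using m k by (simp add: copy_entry_def store_entry_def put_def entry_def)
      show "state \<sigma> q r u (effect J ?c m) \<and> weights_stored w (effect J ?c m) \<and>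
          (\<forall>t'\<le>T. entry r (effect J ?c m) k t' (best J w k t')) \<and>
          (\<forall>t'\<le>t. entry r (effect J ?c m) (Suc k) t' (best J w (Suc k) t')) \<and>
          nmem (effect J ?c m) 11 0 = k \<and>
          nmem (effect J ?c m) 10 0 = t \<and> entry r (effect J ?c m) (Suc k) (Suc t) (?b 0)"
        unfolding eff using m k by (simp add: entry_put)
    qed (simp_all add: copy_entry_def store_entry_def)
    show "hoare J (\<lambda>m. state \<sigma> q r u m \<and> weights_stored w m \<and>
          (\<forall>t'\<le>T. entry r m k t' (best J w k t')) \<and>
          (\<forall>t'\<le>t. entry r m (Suc k) t' (best J w (Suc k) t')) \<and> nmem m 11 0 = k \<and>
          nmem m 10 0 = t \<and> entry r m (Suc k) (Suc t) (?b 0))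
        (For 8 Items table_item) (n * 18 + 3) (\<lambda>m. ?I (Suc t) m \<and> nmem m 10 0 = t)"
    proof (rule hoare_For[where n = n and k = 15 and I = "\<lambda>i m. state \<sigma> q r u m \<and> weights_stored w m \<and>
          (\<forall>t'\<le>T. entry r m k t' (best J w k t')) \<and>
          (\<forall>t'\<le>t. entry r m (Suc k) t' (best J w (Suc k) t')) \<and> nmem m 11 0 = k \<and>
          nmem m 10 0 = t \<and> entry r m (Suc k) (Suc t) (?b i)"], goal_cases)
      case (1 i)
      show ?case using table_item[OF k t 1, where b = "?b i"] by simp
    qed (auto simp: le_Suc_eq)
  qed simp
  show ?thesis
    unfolding table_layer_def
  proof (rule hoare_Seq[OF zero])
    show "hoare J (?I 0) (For 10 (nvar 1) (Seq ?c (For 8 Items table_item))) (T * (n * 18 + 12) + 3)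
        (\<lambda>m. (state \<sigma> q r u m \<and> weights_stored w m \<and>
          (\<forall>t\<le>T. entry r m (Suc k) t (best J w (Suc k) t))) \<and> nmem m 11 0 = k)"
      by (rule hoare_For[OF cell, where n = T]) (auto dest: stateD(2))
  qed simp
qed

lemma tabulate:
  "hoare J (\<lambda>m. state \<sigma> q r u m \<and> weights_stored w m) tabulate
     (n * (T * (n * 18 + 12) + 12) + (T + 1) * 8 + 7)
     (\<lambda>m. state \<sigma> q r u m \<and> weights_stored w m \<and> entry r m n T (best J w n T))"
  unfolding tabulate_def
proof (rule hoare_Seq[OF tabulate_init])
  show "hoare J (\<lambda>m. state \<sigma> q r u m \<and> weights_stored w m \<and> (\<forall>t\<le>T. entry r m 0 t (best J w 0 t)))
      (For 11 Items table_layer) (n * (T * (n * 18 + 12) + 12) + 3)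
      (\<lambda>m. state \<sigma> q r u m \<and> weights_stored w m \<and> entry r m n T (best J w n T))"
    by (rule hoare_For[OF table_layer, where n = n]) auto
qed simp

lemma insert_pick:
  "hoare J (\<lambda>m. state \<sigma> q r u m \<and> weights_stored (gain J \<sigma>) m \<and>
       entry r m n T (best J (gain J \<sigma>) n T))
     insert_pick (n * 6 + 15) (state (advance J \<sigma> r) q r u)"
proof (cases "picks J \<sigma> r")
  case None
  then have "advance J \<sigma> r = \<sigma>" by (simp add: advance_def)
  have none: "\<not> beval J (NLess (Num 0) (NCell (item_row Items) (nvar 1))) m"
    if "state \<sigma> q r u m \<and> weights_stored (gain J \<sigma>) m \<and> entry r m n T (best J (gain J \<sigma>) n T)" for m
    using that None by (auto simp: entry_def dest: stateD(2))
  show ?thesis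
    unfolding insert_pick_def
  proof (rule hoare_Cond[where k = "n * 6 + 14"], goal_cases)
    case 1
    show ?case using none unfolding hoare_def by blast
  next
    case 2
    show ?case using \<open>advance J \<sigma> r = \<sigma>\<close> by (intro hoare_straight) auto
  qed simp
next
  case (Some e)
  obtain i c where "e = (i, c)" by force
  then have p: "picks J \<sigma> r = Some (i, c)" using Some by simp
  note i = picksD[OF p]
  have i': "i < n" using i(2) by (simp add: item_set_def)
  let ?\<sigma> = "\<lambda>j j'. if j' < j \<and> c - size_of J i \<le> \<sigma> j' \<and> \<sigma> j' < c then T else \<sigma> j'"
  let ?P = "\<lambda>m. state \<sigma> q r u m \<and> weights_stored (gain J \<sigma>) m \<and> nmem m 8 0 = i \<and> nmem m 13 0 = c"
  let ?evict = "For 9 Items (Cond (BAnd (nle (NSub (nvar 13) (SizeOf (nvar 8))) (NCell (Num 2) (nvar 9)))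
                  (NLess (NCell (Num 2) (nvar 9)) (nvar 13))) (NStore (Num 2) (nvar 9) (nvar 1)) Skip)"
  have evict: "hoare J ?P ?evict (n * 6 + 3)
      (\<lambda>m. state (?\<sigma> n) q r u m \<and> nmem m 8 0 = i \<and> nmem m 13 0 = c)"
  proof (rule hoare_For[where n = n and k = 3 and
        I = "\<lambda>j m. state (?\<sigma> j) q r u m \<and> nmem m 8 0 = i \<and> nmem m 13 0 = c"])
    fix j assume j: "j < n"
    let ?c = "Cond (BAnd (nle (NSub (nvar 13) (SizeOf (nvar 8))) (NCell (Num 2) (nvar 9)))
                  (NLess (NCell (Num 2) (nvar 9)) (nvar 13))) (NStore (Num 2) (nvar 9) (nvar 1)) Skip"
    show "hoare J (\<lambda>m. (state (?\<sigma> j) q r u m \<and> nmem m 8 0 = i \<and> nmem m 13 0 = c) \<and> nmem m 9 0 = j)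
        ?c 3 (\<lambda>m. (state (?\<sigma> (Suc j)) q r u m \<and> nmem m 8 0 = i \<and> nmem m 13 0 = c) \<and> nmem m 9 0 = j)"
    proof (rule hoare_straight)
      fix m assume m: "(state (?\<sigma> j) q r u m \<and> nmem m 8 0 = i \<and> nmem m 13 0 = c) \<and> nmem m 9 0 = j"
      have s: "nmem m 2 = ?\<sigma> j" "nmem m (Suc 0) 0 = T" using m stateD by blast+
      have eff: "effect J ?c m = (if c - size_of J i \<le> \<sigma> j \<and> \<sigma> j < c then nstore 2 j T m else m)"
        using m s i by (simp add: not_less)
      have "?\<sigma> (Suc j) = (if c - size_of J i \<le> \<sigma> j \<and> \<sigma> j < c then (?\<sigma> j)(j := T) else ?\<sigma> j)"
        by (auto simp: fun_eq_iff less_Suc_eq)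
      then show "(state (?\<sigma> (Suc j)) q r u (effect J ?c m) \<and> nmem (effect J ?c m) 8 0 = i \<and>
          nmem (effect J ?c m) 13 0 = c) \<and> nmem (effect J ?c m) 9 0 = j"
        unfolding eff using m by (simp add: state_def)
    qed simp_all
  qed simp_all
  have store: "hoare J (\<lambda>m. state (?\<sigma> n) q r u m \<and> nmem m 8 0 = i \<and> nmem m 13 0 = c)
      (NStore (Num 2) (nvar 8) (NSub (nvar 13) (SizeOf (nvar 8)))) 1 (state (reschedule J \<sigma> i c) q r u)"
  proof (rule hoare_straight)
    fix m assume m: "state (?\<sigma> n) q r u m \<and> nmem m 8 0 = i \<and> nmem m 13 0 = c"
    \<comment> \<open>The item \<open>i\<close> may itself have been evicted by the loop; its new
      start is written last and overrides this.\<close>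
    have "reschedule J \<sigma> i c = (?\<sigma> n)(i := c - size_of J i)"
      by (auto simp: fun_eq_iff reschedule_def item_set_def)
    then show "state (reschedule J \<sigma> i c) q r u
        (effect J (NStore (Num 2) (nvar 8) (NSub (nvar 13) (SizeOf (nvar 8)))) m)"
      using m i by (simp add: state_def)
  qed simp_all
  have inner: "hoare J ?P
      (Cond (RLess (OfNat (Num 0)) (RCell (NAdd (Num 3) (nvar 8)) (nvar 13)))
        (Seq ?evict (NStore (Num 2) (nvar 8) (NSub (nvar 13) (SizeOf (nvar 8))))) Skip) (n * 6 + 6)
      (state (advance J \<sigma> r) q r u)"
  proof (rule hoare_Cond[where k = "n * 6 + 5"])
    have g: "beval J (RLess (OfNat (Num 0)) (RCell (NAdd (Num 3) (nvar 8)) (nvar 13))) m \<longleftrightarrow>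
        0 < gain J \<sigma> i c" if "?P m" for m
      using that i' i by (simp add: weights_stored_def)
    show "hoare J (\<lambda>m. ?P m \<and> beval J (RLess (OfNat (Num 0)) (RCell (NAdd (Num 3) (nvar 8)) (nvar 13))) m)
        (Seq ?evict (NStore (Num 2) (nvar 8) (NSub (nvar 13) (SizeOf (nvar 8))))) (n * 6 + 5)
        (state (advance J \<sigma> r) q r u)"
    proof (cases "0 < gain J \<sigma> i c")
      case True
      then have "advance J \<sigma> r = reschedule J \<sigma> i c" using p by (simp add: advance_def)
      then show ?thesis
        using hoare_conseq[OF hoare_Seq[OF evict store order_refl]] by fastforce
    next
      case False
      then show ?thesis using g unfolding hoare_def by blast
    qed
    show "hoare J (\<lambda>m. ?P m \<and> \<not> beval J (RLess (OfNat (Num 0)) (RCell (NAdd (Num 3) (nvar 8)) (nvar 13))) m)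
        Skip (n * 6 + 5) (state (advance J \<sigma> r) q r u)"
    proof (rule hoare_straight)
      fix m assume m: "?P m \<and> \<not> beval J (RLess (OfNat (Num 0)) (RCell (NAdd (Num 3) (nvar 8)) (nvar 13))) m"
      then have "advance J \<sigma> r = \<sigma>" using g p by (auto simp: advance_def)
      then show "state (advance J \<sigma> r) q r u (effect J Skip m)" using m by simp
    qed simp_all
  qed simp
  let ?load = "Seq (nassign 8 (NSub (NCell (item_row Items) (nvar 1)) (Num 1)))
                 (nassign 13 (NCell (end_row Items) (nvar 1)))"
  have load: "hoare J (\<lambda>m. state \<sigma> q r u m \<and> weights_stored (gain J \<sigma>) m \<and>
       entry r m n T (best J (gain J \<sigma>) n T)) ?load 3 ?P"
  proof (rule hoare_straight)
    fix m assume m: "state \<sigma> q r u m \<and> weights_stored (gain J \<sigma>) m \<and>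
       entry r m n T (best J (gain J \<sigma>) n T)"
    then have "nmem m (20 + n) T = Suc i" "nmem m (21 + n + n) T = c" "nmem m (Suc 0) 0 = T"
      using p by (auto simp: entry_def dest: stateD(2))
    then show "?P (effect J ?load m)" using m by simp
  qed simp_all
  show ?thesis
    unfolding insert_pick_def
  proof (rule hoare_Cond[where k = "n * 6 + 14"])
    show "hoare J (\<lambda>m. (state \<sigma> q r u m \<and> weights_stored (gain J \<sigma>) m \<and>
        entry r m n T (best J (gain J \<sigma>) n T)) \<and>
        beval J (NLess (Num 0) (NCell (item_row Items) (nvar 1))) m)
        (Seq ?load (Cond (RLess (OfNat (Num 0)) (RCell (NAdd (Num 3) (nvar 8)) (nvar 13)))
          (Seq ?evict (NStore (Num 2) (nvar 8) (NSub (nvar 13) (SizeOf (nvar 8))))) Skip))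
        (n * 6 + 14) (state (advance J \<sigma> r) q r u)"
      by (rule hoare_conseq[OF hoare_Seq[OF load inner order_refl]]) auto
    show "hoare J (\<lambda>m. (state \<sigma> q r u m \<and> weights_stored (gain J \<sigma>) m \<and>
        entry r m n T (best J (gain J \<sigma>) n T)) \<and>
        \<not> beval J (NLess (Num 0) (NCell (item_row Items) (nvar 1))) m)
        Skip (n * 6 + 14) (state (advance J \<sigma> r) q r u)"
      using p by (intro hoare_straight) (auto simp: entry_def dest: stateD(2))
  qed simp
qed

end

section \<open>Rounds, output and total running time\<close>

context valid_knapsack
begin

abbreviation "round_time \<equiv> 40 * (T + 1) * (n + 1)\<^sup>2"

lemma shrink:
  "hoare J (state \<sigma> q r u) shrink 1 (state \<sigma> q r (u * (1 - 1 / real q)))"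
  by (rule hoare_straight) (auto simp: shrink_def state_def)

lemma round:
  "hoare J (state \<sigma> q r u) (Seq weigh (Seq tabulate (Seq insert_pick shrink))) round_time
     (state (advance J \<sigma> r) q r (u * (1 - 1 / real q)))"
proof -
  have w: "hoare J (state \<sigma> q r u) weigh (n * ((T + 1) * (n * 10 + 23) + 10) + 3)
     (\<lambda>m. state \<sigma> q r u m \<and> weights_stored (gain J \<sigma>) m)"
    using weigh unfolding weights_stored_def by simp
  let ?t1 = "n * ((T + 1) * (n * 10 + 23) + 10) + 3"
  let ?t2 = "n * (T * (n * 18 + 12) + 12) + (T + 1) * 8 + 7"
  let ?t3 = "n * 6 + 15"
  have "Suc (?t1 + Suc (?t2 + Suc (?t3 + 1))) \<le> round_time"
  proof -
    have "?t1 \<le> (T + 1) * (n * (n * 10 + 33) + 3)" by (simp add: algebra_simps)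
    moreover have "?t2 \<le> (T + 1) * (n * (n * 18 + 24) + 15)" by (simp add: algebra_simps)
    moreover have "?t3 + 4 \<le> (T + 1) * (n * 6 + 19)" by (simp add: algebra_simps)
    ultimately have "Suc (?t1 + Suc (?t2 + Suc (?t3 + 1))) \<le>
        (T + 1) * ((n * (n * 10 + 33) + 3) + (n * (n * 18 + 24) + 15) + (n * 6 + 19))"
      unfolding distrib_left by linarith
    also have "\<dots> \<le> (T + 1) * (40 * (n + 1)\<^sup>2)"
      by (intro mult_left_mono) (simp_all add: power2_eq_square algebra_simps)
    finally show ?thesis by (simp only: mult.assoc mult.left_commute[of _ 40])
  qed
  with hoare_Seq[OF w hoare_Seq[OF tabulate hoare_Seq[OF insert_pick shrink order_refl] order_refl]]
  show ?thesis by blast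
qed

text \<open>Induction on the number \<open>j\<close> of remaining rounds, which the memory reflects
  only through the power \<open>v ^ (K - j)\<close>.\<close>

lemma iterate:
  fixes v :: real
  defines "v \<equiv> 1 - 1 / real (draw_range n)" and "K \<equiv> rounds (draw_range n)"
  assumes "j \<le> K" "nmem m 1 0 = T" "nmem m 2 = \<sigma>" "rmem m 0 0 = v ^ (K - j)"
  shows "\<exists>M. runs J iterate m M (j * (round_time + 6 * n + 7) + 1) \<and>
    map_pmf (\<lambda>m. nmem m 2) M = chain J (draw_range n) j \<sigma> \<and> (\<forall>m'\<in>set_pmf M. nmem m' 1 0 = T)"
  using assms(3-)
proof (induction j arbitrary: m \<sigma>)
  case 0
  have "\<not> beval J (RLess (RDiv (OfNat (Num 1)) (OfNat (Num 2))) (rvar 0)) m"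
    using 0 rounds(2)[of "draw_range n"] by (simp add: v_def K_def draw_range_def)
  from runs_Loop_False[OF this] show ?case
    using 0 by (intro exI[of _ "return_pmf m"]) (simp add: iterate_def)
next
  case (Suc j)
  let ?N = "draw_range n" and ?step = "Seq weigh (Seq tabulate (Seq insert_pick shrink))"
  have guard: "beval J (RLess (RDiv (OfNat (Num 1)) (OfNat (Num 2))) (rvar 0)) m"
    using Suc.prems rounds(3)[of ?N "K - Suc j"] by (simp add: v_def K_def draw_range_def)
  obtain D where D: "runs J draw m D (draw_exponent n * 6 + 5)"
    "map_pmf (\<lambda>m. nmem m 5 0) D = pmf_of_set {..<?N}"
    "\<And>m'. m' \<in> set_pmf D \<Longrightarrow> nmem m' 4 0 = ?N \<and> draw_frame m m'"
    using draw[of J m] by blast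
  have st: "state \<sigma> ?N (nmem m' 5 0) (v ^ (K - Suc j)) m'" if "m' \<in> set_pmf D" for m'
    using D(3)[OF that] Suc.prems by (simp add: state_def draw_frame_def)
  have vj: "v ^ (K - Suc j) * (1 - 1 / real ?N) = v ^ (K - j)"
    using Suc.prems(1) by (simp add: v_def Suc_diff_Suc flip: power_Suc2)
  have "\<exists>m''. runs J ?step m' (return_pmf m'') round_time \<and>
      state (advance J \<sigma> (nmem m' 5 0)) ?N (nmem m' 5 0) (v ^ (K - j)) m''" if "m' \<in> set_pmf D" for m'
    \<comment> \<open>Once \<open>r\<close> is drawn, the rest of a round is deterministic, which
      yields the function \<open>g\<close> on memories below.\<close>
    using round st[OF that] unfolding hoare_def vj[symmetric] by blast
  then obtain g where g: "\<And>m'. m' \<in> set_pmf D \<Longrightarrow> runs J ?step m' (return_pmf (g m')) round_time"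
    "\<And>m'. m' \<in> set_pmf D \<Longrightarrow>
      state (advance J \<sigma> (nmem m' 5 0)) ?N (nmem m' 5 0) (v ^ (K - j)) (g m')"
    by metis
  have body: "runs J (Seq draw ?step) m (map_pmf g D) (Suc (draw_exponent n * 6 + 5 + round_time))"
    using runs_Seq[OF D(1) g(1)] by (simp add: map_pmf_def)
  have "\<exists>M. runs J iterate (g m') M (j * (round_time + 6 * n + 7) + 1) \<and>
      map_pmf (\<lambda>m. nmem m 2) M = chain J ?N j (nmem (g m') 2) \<and> (\<forall>m''\<in>set_pmf M. nmem m'' 1 0 = T)"
    if "m' \<in> set_pmf D" for m'
    using Suc.IH[of "g m'" "nmem (g m') 2"] Suc.prems(1) stateD[OF g(2)[OF that]] by simp
  then have "\<forall>x\<in>g ` set_pmf D. \<exists>M. runs J iterate x M (j * (round_time + 6 * n + 7) + 1) \<and>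
      map_pmf (\<lambda>m. nmem m 2) M = chain J ?N j (nmem x 2) \<and> (\<forall>m''\<in>set_pmf M. nmem m'' 1 0 = T)"
    by blast
  then obtain L where L: "\<And>x. x \<in> g ` set_pmf D \<Longrightarrow>
      runs J iterate x (L x) (j * (round_time + 6 * n + 7) + 1)"
    "\<And>x. x \<in> g ` set_pmf D \<Longrightarrow> map_pmf (\<lambda>m. nmem m 2) (L x) = chain J ?N j (nmem x 2)"
    "\<And>x m''. x \<in> g ` set_pmf D \<Longrightarrow> m'' \<in> set_pmf (L x) \<Longrightarrow> nmem m'' 1 0 = T"
    using bchoice[of "g ` set_pmf D"] by (metis (no_types, lifting))
  let ?M = "bind_pmf (map_pmf g D) L"
  have "runs J iterate m ?M (Suc (Suc (draw_exponent n * 6 + 5 + round_time) +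
      (j * (round_time + 6 * n + 7) + 1)))"
    unfolding iterate_def
    by (rule runs_Loop_True[OF guard body]) (use L(1) in \<open>simp add: iterate_def\<close>)
  then have "runs J iterate m ?M (Suc j * (round_time + 6 * n + 7) + 1)"
    by (rule runs_weaken) (use draw_exponent(3)[of n] in simp)
  moreover have "map_pmf (\<lambda>m. nmem m 2) ?M = chain J ?N (Suc j) \<sigma>"
  proof -
    have "map_pmf (\<lambda>m. nmem m 2) ?M = bind_pmf D (\<lambda>m'. chain J ?N j (advance J \<sigma> (nmem m' 5 0)))"
      unfolding map_bind_pmf bind_map_pmf
      using L(2) stateD(3)[OF g(2)] by (intro bind_pmf_cong refl) simp
    \<comment> \<open>The remaining rounds depend on the draw only through row 5, whose law is
      uniform by \<open>D(2)\<close>.\<close>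
    also have "\<dots> = chain J ?N (Suc j) \<sigma>"
      by (simp add: bind_map_pmf flip: D(2))
    finally show ?thesis .
  qed
  moreover have "\<forall>m'\<in>set_pmf ?M. nmem m' 1 0 = T" using L(3) by auto
  ultimately show ?case by blast
qed

lemma setup_plan:
  "hoare J (\<lambda>m. nmem m = (\<lambda>_ _. 0)) setup_plan (8 * n + 9)
     (\<lambda>m. nmem m 1 0 = T \<and> nmem m 2 = initial_plan J \<and> rmem m 0 0 = 1)"
proof -
  have total: "hoare J (\<lambda>m. nmem m = (\<lambda>_ _. 0)) (For 8 Items (nassign 1 (NAdd (nvar 1) (SizeOf (nvar 8)))))
      (n * 4 + 3) (\<lambda>m. nmem m 1 0 = T \<and> nmem m 2 = (\<lambda>_. 0))"
  proof (rule hoare_For[where n = n and k = 1 and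
        I = "\<lambda>i m. nmem m 1 0 = (\<Sum>i'<i. size_of J i') \<and> nmem m 2 = (\<lambda>_. 0)"])
    fix i assume "i < n"
    then show "hoare J (\<lambda>m. (nmem m 1 0 = (\<Sum>i'<i. size_of J i') \<and> nmem m 2 = (\<lambda>_. 0)) \<and> nmem m 8 0 = i)
        (nassign 1 (NAdd (nvar 1) (SizeOf (nvar 8)))) 1
        (\<lambda>m. (nmem m 1 0 = (\<Sum>i'<Suc i. size_of J i') \<and> nmem m 2 = (\<lambda>_. 0)) \<and> nmem m 8 0 = i)"
      by (intro hoare_straight) (auto simp: item_set_def)
  qed (auto simp: total_size_def item_set_def)
  have plan: "hoare J (\<lambda>m. nmem m 1 0 = T \<and> nmem m 2 = (\<lambda>_. 0)) (For 8 Items (NStore (Num 2) (nvar 8) (nvar 1)))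
      (n * 4 + 3) (\<lambda>m. nmem m 1 0 = T \<and> nmem m 2 = initial_plan J)"
  proof (rule hoare_For[where n = n and k = 1 and
        I = "\<lambda>i m. nmem m 1 0 = T \<and> nmem m 2 = (\<lambda>j. if j < i then T else 0)"])
    fix i assume "i < n"
    show "hoare J (\<lambda>m. (nmem m 1 0 = T \<and> nmem m 2 = (\<lambda>j. if j < i then T else 0)) \<and> nmem m 8 0 = i)
        (NStore (Num 2) (nvar 8) (nvar 1)) 1
        (\<lambda>m. (nmem m 1 0 = T \<and> nmem m 2 = (\<lambda>j. if j < Suc i then T else 0)) \<and> nmem m 8 0 = i)"
      by (rule hoare_straight) (auto simp: fun_eq_iff)
  qed (auto simp: initial_plan_def item_set_def fun_eq_iff)
  have unit: "hoare J (\<lambda>m. nmem m 1 0 = T \<and> nmem m 2 = initial_plan J) (rassign 0 (OfNat (Num 1))) 1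
      (\<lambda>m. nmem m 1 0 = T \<and> nmem m 2 = initial_plan J \<and> rmem m 0 0 = 1)"
    by (rule hoare_straight) auto
  show ?thesis
    unfolding setup_plan_def by (rule hoare_Seq[OF total hoare_Seq[OF plan unit order_refl]]) simp
qed

definition emitted :: "nat list \<Rightarrow> memory \<Rightarrow> bool" where
  "emitted xs m \<longleftrightarrow> nmem m 12 0 = length xs \<and> (\<forall>p<length xs. nmem m 0 p = xs ! p)"

lemma emit:
  assumes f: "feasible J \<sigma>"
  shows "hoare J (\<lambda>m. nmem m 1 0 = T \<and> nmem m 2 = \<sigma>) emit ((T + 1) * (8 * n + 6) + 5)
     (\<lambda>m. map (nmem m 0) [0..<n] = bucket_sort J \<sigma>)"
proof -
  let ?S = "\<lambda>m. nmem m 1 0 = T \<and> nmem m 2 = \<sigma>"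
  let ?xs = "\<lambda>t i. bucket_prefix J \<sigma> t @ filter (\<lambda>i. \<sigma> i = t) [0..<i]"
  let ?c = "Cond (neq (NCell (Num 2) (nvar 8)) (nvar 10))
        (Seq (NStore (Num 0) (nvar 12) (nvar 8)) (nassign 12 (NAdd (nvar 12) (Num 1)))) Skip"
  have inner: "hoare J (\<lambda>m. (?S m \<and> emitted (bucket_prefix J \<sigma> t) m) \<and> nmem m 10 0 = t)
      (For 8 Items ?c) (8 * n + 3)
      (\<lambda>m. (?S m \<and> emitted (bucket_prefix J \<sigma> (Suc t)) m) \<and> nmem m 10 0 = t)" for t
  proof (rule hoare_For[where n = n and k = 5 and
        I = "\<lambda>i m. ?S m \<and> emitted (?xs t i) m \<and> nmem m 10 0 = t"])
    fix i assume i: "i < n"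
    show "hoare J (\<lambda>m. (?S m \<and> emitted (?xs t i) m \<and> nmem m 10 0 = t) \<and> nmem m 8 0 = i) ?c 5
        (\<lambda>m. (?S m \<and> emitted (?xs t (Suc i)) m \<and> nmem m 10 0 = t) \<and> nmem m 8 0 = i)"
    proof (rule hoare_straight)
      fix m assume m: "(?S m \<and> emitted (?xs t i) m \<and> nmem m 10 0 = t) \<and> nmem m 8 0 = i"
      let ?l = "length (?xs t i)"
      have eff: "effect J ?c m = (if \<sigma> i = t then nstore 12 0 (Suc ?l) (nstore 0 ?l i m) else m)"
        using m by (auto simp: emitted_def)
      have "?xs t (Suc i) = (if \<sigma> i = t then ?xs t i @ [i] else ?xs t i)" by simp
      then show "(?S (effect J ?c m) \<and> emitted (?xs t (Suc i)) (effect J ?c m) \<and>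
          nmem (effect J ?c m) 10 0 = t) \<and> nmem (effect J ?c m) 8 0 = i"
        unfolding eff using m by (auto simp: emitted_def nth_append less_Suc_eq)
    qed simp_all
  qed (auto simp: emitted_def bucket_prefix_def)
  \<comment> \<open>Feasibility bounds all starts by \<open>T\<close>, so every item lands in some
    bucket.\<close>
  have len: "length (bucket_sort J \<sigma>) = n"
    using bucket_sort_solution[OF f] distinct_card[of "bucket_sort J \<sigma>"]
    by (simp add: solutions_def permutations_of_set_def item_set_def)
  have main: "hoare J (\<lambda>m. ?S m \<and> nmem m 12 0 = 0) (For 10 (NAdd (nvar 1) (Num 1)) (For 8 Items ?c))
      ((T + 1) * (8 * n + 6) + 3) (\<lambda>m. map (nmem m 0) [0..<n] = bucket_sort J \<sigma>)"
  proof (rule hoare_For[where n = "T + 1" and k = "8 * n + 3" and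
        I = "\<lambda>t m. ?S m \<and> emitted (bucket_prefix J \<sigma> t) m", OF inner])
    fix m assume "?S m \<and> emitted (bucket_prefix J \<sigma> (T + 1)) m"
    then show "map (nmem m 0) [0..<n] = bucket_sort J \<sigma>"
      using len by (intro nth_equalityI) (auto simp: emitted_def)
  qed (auto simp: emitted_def bucket_prefix_def)
  show ?thesis
    unfolding emit_def
    by (rule hoare_Seq[OF hoare_straight[where k = 1] main]) auto
qed

lemma algorithm_runs:
  "\<exists>M. runs J algorithm \<lparr>nmem = \<lambda>_ _. 0, rmem = \<lambda>_ _. 0\<rparr> M (250 * (T + 1) * (n + 1) ^ 3) \<and>
    map_pmf (\<lambda>m. map (nmem m 0) [0..<n]) M =
      map_pmf (bucket_sort J) (chain J (draw_range n) (rounds (draw_range n)) (initial_plan J))"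
proof -
  let ?m0 = "\<lparr>nmem = \<lambda>_ _. 0, rmem = \<lambda>_ _. 0\<rparr>" and ?K = "rounds (draw_range n)"
  have N: "0 < draw_range n" by (simp add: draw_range_def)
  obtain m1 where m1: "runs J setup_plan ?m0 (return_pmf m1) (8 * n + 9)"
    "nmem m1 1 0 = T" "nmem m1 2 = initial_plan J" "rmem m1 0 0 = 1"
    using setup_plan[unfolded hoare_def, rule_format, of ?m0] by auto
  then obtain M where M: "runs J iterate m1 M (?K * (round_time + 6 * n + 7) + 1)"
    "map_pmf (\<lambda>m. nmem m 2) M = chain J (draw_range n) ?K (initial_plan J)"
    "\<And>m'. m' \<in> set_pmf M \<Longrightarrow> nmem m' 1 0 = T"
    using iterate[of ?K m1 "initial_plan J"] by auto
  have "feasible J (nmem m' 2)" if "m' \<in> set_pmf M" for m'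
  proof -
    have "nmem m' 2 \<in> set_pmf (chain J (draw_range n) ?K (initial_plan J))"
      unfolding M(2)[symmetric] using that by auto
    then show ?thesis using chain_support[OF N] feasible_initial by blast
  qed
  then have "\<exists>m''. runs J emit m' (return_pmf m'') ((T + 1) * (8 * n + 6) + 5) \<and>
      map (nmem m'' 0) [0..<n] = bucket_sort J (nmem m' 2)" if "m' \<in> set_pmf M" for m'
    using emit[of "nmem m' 2"] M(3)[OF that] that unfolding hoare_def by blast
  then obtain g where g: "\<And>m'. m' \<in> set_pmf M \<Longrightarrow> runs J emit m' (return_pmf (g m')) ((T + 1) * (8 * n + 6) + 5)"
    "\<And>m'. m' \<in> set_pmf M \<Longrightarrow> map (nmem (g m') 0) [0..<n] = bucket_sort J (nmem m' 2)"
    by metis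
  let ?k = "Suc (8 * n + 9 + Suc (?K * (round_time + 6 * n + 7) + 1 + ((T + 1) * (8 * n + 6) + 5)))"
  have rest: "runs J (Seq iterate emit) m1 (map_pmf g M)
      (Suc (?K * (round_time + 6 * n + 7) + 1 + ((T + 1) * (8 * n + 6) + 5)))"
    using runs_Seq[OF M(1) g(1)] by (simp add: map_pmf_def)
  have "runs J algorithm ?m0 (bind_pmf (return_pmf m1) (\<lambda>_. map_pmf g M)) ?k"
    unfolding algorithm_def by (rule runs_Seq[OF m1(1)]) (use rest in auto)
  then have "runs J algorithm ?m0 (map_pmf g M) ?k" by (simp only: bind_return_pmf)
  moreover have "?k \<le> 250 * (T + 1) * (n + 1) ^ 3"
  proof -
    let ?b = "n + 1" and ?a = "T + 1"
    have b: "?b \<le> ?b\<^sup>2" "?b\<^sup>2 \<le> ?b ^ 3"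
      using self_le_power[of ?b 2] power_increasing[of 2 3 ?b] by auto
    have p: "?a * ?b \<le> ?a * ?b\<^sup>2" "?a * ?b\<^sup>2 \<le> ?a * ?b ^ 3" "?b \<le> ?a * ?b"
      by (rule mult_le_mono2[OF b(1)], rule mult_le_mono2[OF b(2)], simp)
    \<comment> \<open>The number of rounds is at most the range, hence at most
      \<open>2 * n + 4\<close>. The rounds cost 4 * 47 = 188 units; the rest of 250 leaves room for
      setup and output.\<close>
    have "?K \<le> 4 * ?b" using rounds(1)[OF N] draw_range_le[of n] by simp
    moreover have "round_time + 6 * n + 7 \<le> 47 * (?a * ?b\<^sup>2)"
    proof -
      have "round_time = 40 * (?a * ?b\<^sup>2)" by (simp only: mult.assoc)
      moreover have "6 * n + 7 \<le> 7 * ?b" by simp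
      ultimately show ?thesis using p by linarith
    qed
    ultimately have "?K * (round_time + 6 * n + 7) \<le> (4 * ?b) * (47 * (?a * ?b\<^sup>2))"
      by (rule mult_le_mono)
    also have "(4 * x) * (47 * (y * x\<^sup>2)) = 188 * (y * x ^ 3)" for x y :: nat
      by (simp add: power3_eq_cube power2_eq_square)
    finally have "?K * (round_time + 6 * n + 7) \<le> 188 * (?a * ?b ^ 3)" .
    moreover have "?a * (8 * n + 6) \<le> ?a * (8 * ?b)" by (rule mult_le_mono2) simp
    then have "?a * (8 * n + 6) \<le> 8 * (?a * ?b)" by (simp only: mult.left_commute)
    ultimately have "?k \<le> 250 * (?a * ?b ^ 3)" using p by linarith
    then show ?thesis by (simp only: mult.assoc)
  qed
  ultimately have "runs J algorithm ?m0 (map_pmf g M) (250 * (T + 1) * (n + 1) ^ 3)"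
    by (rule runs_weaken)
  moreover have "map_pmf (\<lambda>m. map (nmem m 0) [0..<n]) (map_pmf g M) =
      map_pmf (bucket_sort J) (chain J (draw_range n) ?K (initial_plan J))"
    unfolding M(2)[symmetric] pmf.map_comp
    using g(2) by (intro map_pmf_cong) auto
  ultimately show ?thesis by blast
qed

text \<open>With at least one item the total size is positive, so the logarithmic factor is at least
  1. Thus polynomial bounds in \<open>n\<close> carry over to the input size.\<close>

lemma items_le_input_size: "real n \<le> input_size J"
proof (cases "n = 0")
  case False
  then have "0 < T"
    using size_pos[of 0] member_le_sum[of 0 "item_set J" "size_of J"]
    by (auto simp: total_size_def item_set_def)
  then have "1 \<le> log 2 (real T + 1)" by (simp add: le_log_iff)
  then show ?thesis
    unfolding input_size_def using mult_left_mono[of 1 "log 2 (real T + 1)" "real n"] by simp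
qed (simp add: input_size_def)

end

theorem theorem8:
  shows "\<exists>(P :: com) (\<epsilon> :: real \<Rightarrow> real).
           pseudo_polynomial_time P \<and>
           \<epsilon> \<in> o(\<lambda>_. 1) \<and>
           approximation_algorithm P (\<lambda>J. 1 / 4 - \<epsilon> (input_size J))"
proof (intro exI conjI)
  show "pseudo_polynomial_time algorithm"
    unfolding pseudo_polynomial_time_def
  proof (intro exI allI impI conjI)
    fix J assume "valid_instance J"
    then interpret valid_knapsack J by unfold_locales
    obtain M where M: "runs J algorithm \<lparr>nmem = \<lambda>_ _. 0, rmem = \<lambda>_ _. 0\<rparr> M
        (250 * (total_size J + 1) * (items J + 1) ^ 3)"
      using algorithm_runs by blast
    show "halts algorithm J" using runs_run(1)[OF M] .
    have "real (running_time algorithm J) \<le> real (250 * (total_size J + 1) * (items J + 1) ^ 3)"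
      using runs_run(2)[OF M] by (simp only: of_nat_le_iff)
    also have "\<dots> = 250 * (real (total_size J) + 1) * (real (items J) + 1) ^ 3" by (simp add: add.commute)
    also have "\<dots> \<le> 250 * (real (total_size J) + 1) * (input_size J + 1) ^ 3"
      using items_le_input_size by (intro mult_left_mono power_mono) auto
    finally show "real (running_time algorithm J) \<le>
        250 * (real (total_size J) + 1) * (input_size J + 1) ^ 3" .
  qed
  \<comment> \<open>The ratio is exactly 1/4 on every instance, so the error term is chosen to be
    0.\<close>
  show "(\<lambda>_. 0) \<in> o(\<lambda>_ :: real. 1 :: real)" by simp
  show "approximation_algorithm algorithm (\<lambda>J. 1 / 4 - (\<lambda>_. 0) (input_size J))"
    unfolding approximation_algorithm_def
  proof (intro allI impI conjI)
    fix J assume "valid_instance J"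
    then interpret valid_knapsack J by unfold_locales
    let ?N = "draw_range (items J)"
    let ?M = "chain J ?N (rounds ?N) (initial_plan J)"
    have N: "items J + 2 \<le> ?N" by (rule draw_exponent)
    obtain M where M: "runs J algorithm \<lparr>nmem = \<lambda>_ _. 0, rmem = \<lambda>_ _. 0\<rparr> M
        (250 * (total_size J + 1) * (items J + 1) ^ 3)"
      "map_pmf (\<lambda>m. map (nmem m 0) [0..<items J]) M = map_pmf (bucket_sort J) ?M"
      using algorithm_runs by blast
    show "halts algorithm J" using runs_run(1)[OF M(1)] .
    have out: "output_pmf algorithm J = map_pmf (bucket_sort J) ?M"
      using runs_run(3)[OF M(1)] M(2) by simp
    show "set_pmf (output_pmf algorithm J) \<subseteq> solutions J"
      unfolding out using chain_support[of ?N] feasible_initial bucket_sort_solution N by auto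
    show "(1 / 4 - 0) * opt J \<le> measure_pmf.expectation (output_pmf algorithm J) (objective J)"
      unfolding out using chain_objective[of ?N] N by simp
  qed
qed

end
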